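(* Let $g\ge1$ and let $I\subset\mathbb{K}[u_1,\dots,u_g,v_1,\dots,v_g,w_1,\dots,w_g]$ be the prime ideal of the Hirota variety of the simplex with the parametric representation $$u_j\mapsto\kappa_j-\kappa_0,\quad v_j\mapsto\kappa_j^2-\kappa_0^2,\quad w_j\mapsto\kappa_j^3-\kappa_0^3\qquad(j=1,\dots,g).$$ Then $I$ is minimally generated by the following polynomials: (a) the $\binom g2$ cubics $\underline{v_iu_j}-v_ju_i-u_iu_j(u_i-u_j)$ for $1\le i<j\le g$; (b) the $g$ quartics $4\underline{w_iu_i}-3v_i^2-u_i^4$ for $i=1,\dots,g$; (c) the $g(g-1)$ quartics $4\underline{w_ju_i}-3v_iv_j+3u_i(u_i-u_j)v_j-u_iu_j^3$ for $i\ne j$, $1\le i,j\le g$; (d) the $\binom g2$ quintics $4\underline{w_iv_j}-4w_jv_i+3u_iv_j(v_j-v_i)+u_iv_j(u_j-u_i)(u_i-2u_j)+u_iu_j^3(u_i-u_j)$ for $1\le i<j\le g$. Moreover, these $2g^2-g$ ideal generators are a minimal Gröbner basis of $I$ with the underlined leading terms (that is, with respect to a monomial order that selects the underlined monomials as leading monomials).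
   Context: $\mathbb{K}$ is a field of characteristic zero. The variables have weights $\deg u_i=1$, $\deg v_i=2$, $\deg w_i=3$ and are coordinates on the weighted projective space $\mathbb{WP}^{3g-1}$; the words cubic, quartic, quintic refer to this grading. The prime ideal of the parametrized variety is the kernel of the $\mathbb{K}$-algebra homomorphism $\mathbb{K}[u_1,\dots,w_g]\to\mathbb{K}[\kappa_0,\kappa_1,\dots,\kappa_g]$ given by the displayed parametrization. (This variety is one of the components of the Hirota variety of $\mathcal{C}=\{\mathbf{0},\mathbf{e}_1,\dots,\mathbf{e}_g\}$, which parametrizes the $(\mathbf u,\mathbf v,\mathbf w)$ for which $a_0+\sum_{j=1}^ga_j\exp[u_jx+v_jy+w_jt]$ solves Hirota's differential equation.) *)

theory Defs
  imports Complex_Main "HOL-Library.Poly_Mapping" "HOL-Library.Cardinality"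
begin

section \<open>Polynomial rings\<close>

text \<open>
  Monomials are finitely supported exponent functions, written additively; polynomials are finitely
  supported coefficient functions on monomials with the convolution product of
  \<^theory>\<open>HOL-Library.Poly_Mapping\<close>.  Thus \<open>('x, 'k) mpoly\<close> is the ring of polynomials over \<open>'k\<close>
  with one variable for every element of the type \<open>'x\<close>.
\<close>

type_synonym 'x monom = "'x \<Rightarrow>\<^sub>0 nat"
type_synonym ('x, 'k) mpoly = "'x monom \<Rightarrow>\<^sub>0 'k"

definition mvar :: "'x \<Rightarrow> 'x monom" where
  "mvar x = Poly_Mapping.single x 1"

definition Monom :: "'x monom \<Rightarrow> ('x, 'k::comm_semiring_1) mpoly" where
  "Monom m = Poly_Mapping.single m 1"

definition Var :: "'x \<Rightarrow> ('x, 'k::comm_semiring_1) mpoly" where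
  "Var x = Monom (mvar x)"

definition Const :: "'k \<Rightarrow> ('x, 'k::comm_semiring_1) mpoly" where
  "Const c = Poly_Mapping.single 0 c"

definition poly_subst ::
  "('x \<Rightarrow> ('y, 'k) mpoly) \<Rightarrow> ('x, 'k::comm_semiring_1) mpoly \<Rightarrow> ('y, 'k) mpoly" where
  "poly_subst f p =
    (\<Sum>m\<in>Poly_Mapping.keys p.
      Const (Poly_Mapping.lookup p m) *
      (\<Prod>x\<in>Poly_Mapping.keys m. f x ^ Poly_Mapping.lookup m x))"

text \<open>
  The following lemmas show that \<^term>\<open>poly_subst f\<close> is the homomorphism of algebras sending each
  variable \<open>x\<close> to \<open>f x\<close>.
\<close>

lemma Const_0 [simp]: "Const 0 = 0"
  by (simp add: Const_def)

lemma Const_1 [simp]: "Const 1 = 1"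
  by (simp add: Const_def)

lemma Const_add: "Const (a + b) = Const a + Const b"
  by (simp add: Const_def single_add)

lemma Const_mult: "Const (a * b) = Const a * Const b"
  by (simp add: Const_def mult_single)

lemma poly_subst_superset:
  assumes "finite S" "Poly_Mapping.keys p \<subseteq> S"
  shows "poly_subst f p =
    (\<Sum>m\<in>S. Const (Poly_Mapping.lookup p m) *
      (\<Prod>x\<in>Poly_Mapping.keys m. f x ^ Poly_Mapping.lookup m x))"
  unfolding poly_subst_def using assms
  by (intro sum.mono_neutral_left) (auto simp: in_keys_iff)

lemma poly_subst_0 [simp]: "poly_subst f 0 = 0"
  by (simp add: poly_subst_def)

lemma poly_subst_add: "poly_subst f (p + q) = poly_subst f p + poly_subst f q"
proof -
  let ?S = "Poly_Mapping.keys p \<union> Poly_Mapping.keys q"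
  have "Poly_Mapping.keys (p + q) \<subseteq> ?S"
    by (rule keys_add)
  then show ?thesis
    by (simp add: poly_subst_superset[of ?S] lookup_add Const_add distrib_right sum.distrib)
qed

lemma poly_subst_sum: "poly_subst f (sum g A) = (\<Sum>a\<in>A. poly_subst f (g a))"
  by (induction A rule: infinite_finite_induct) (simp_all add: poly_subst_add)

lemma poly_subst_single:
  "poly_subst f (Poly_Mapping.single m c) =
    Const c * (\<Prod>x\<in>Poly_Mapping.keys m. f x ^ Poly_Mapping.lookup m x)"
  by (simp add: poly_subst_def)

lemma poly_subst_Const [simp]: "poly_subst f (Const c) = Const c"
  using poly_subst_single[of f 0 c] by (simp add: Const_def)

lemma poly_subst_1 [simp]: "poly_subst f 1 = 1"
  using poly_subst_Const[of f 1] by simp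

lemma poly_subst_Var [simp]: "poly_subst f (Var x) = f x"
  by (simp add: Var_def Monom_def mvar_def poly_subst_single)

lemma monom_prod_superset:
  fixes f :: "'x \<Rightarrow> 'a::comm_semiring_1"
  assumes "finite S" "Poly_Mapping.keys m \<subseteq> S"
  shows "(\<Prod>x\<in>Poly_Mapping.keys m. f x ^ Poly_Mapping.lookup m x)
    = (\<Prod>x\<in>S. f x ^ Poly_Mapping.lookup m x)"
  using assms by (intro prod.mono_neutral_left) (auto simp: in_keys_iff)

lemma monom_prod_add:
  fixes f :: "'x \<Rightarrow> 'a::comm_semiring_1"
  shows "(\<Prod>x\<in>Poly_Mapping.keys (m + n). f x ^ Poly_Mapping.lookup (m + n) x)
    = (\<Prod>x\<in>Poly_Mapping.keys m. f x ^ Poly_Mapping.lookup m x)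
      * (\<Prod>x\<in>Poly_Mapping.keys n. f x ^ Poly_Mapping.lookup n x)"
proof -
  let ?S = "Poly_Mapping.keys m \<union> Poly_Mapping.keys n"
  have "Poly_Mapping.keys (m + n) \<subseteq> ?S"
    by (rule keys_add)
  then have "(\<Prod>x\<in>Poly_Mapping.keys (m + n). f x ^ Poly_Mapping.lookup (m + n) x)
      = (\<Prod>x\<in>?S. f x ^ Poly_Mapping.lookup (m + n) x)"
    by (intro monom_prod_superset) auto
  also have "\<dots> = (\<Prod>x\<in>?S. f x ^ Poly_Mapping.lookup m x)
      * (\<Prod>x\<in>?S. f x ^ Poly_Mapping.lookup n x)"
    by (simp only: lookup_add power_add prod.distrib)
  finally show ?thesis
    by (simp only: monom_prod_superset[of ?S m f] monom_prod_superset[of ?S n f]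
        finite_UnI finite_keys Un_upper1 Un_upper2)
qed

lemma mpoly_eq_sum_single:
  "p = (\<Sum>m\<in>Poly_Mapping.keys p. Poly_Mapping.single m (Poly_Mapping.lookup p m))"
  by (rule poly_mapping_eqI) (auto simp: lookup_sum lookup_single when_def in_keys_iff)

lemma poly_subst_mult: "poly_subst f (p * q) = poly_subst f p * poly_subst f q"
proof -
  let ?s = "\<lambda>p m. Poly_Mapping.single m (Poly_Mapping.lookup p m)"
  let ?P = "Poly_Mapping.keys p" and ?Q = "Poly_Mapping.keys q"
  have single: "poly_subst f (Poly_Mapping.single m c * Poly_Mapping.single n d) =
      poly_subst f (Poly_Mapping.single m c) * poly_subst f (Poly_Mapping.single n d)" for m n c d
    by (simp add: mult_single poly_subst_single monom_prod_add Const_mult mult_ac)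
  have "poly_subst f (sum (?s p) ?P * sum (?s q) ?Q)
      = poly_subst f (sum (?s p) ?P) * poly_subst f (sum (?s q) ?Q)"
    by (simp add: sum_product poly_subst_sum single)
  then show ?thesis
    by (simp flip: mpoly_eq_sum_single)
qed


section \<open>Ideals, minimal generators and Groebner bases\<close>

text \<open>The ideal generated by a set is its span in the ring, viewed as a module over itself.\<close>

lemma module_times: "module ((*) :: 'a::comm_ring_1 \<Rightarrow> 'a \<Rightarrow> 'a)"
  by unfold_locales (simp_all add: algebra_simps)

abbreviation ideal_of :: "'a::comm_ring_1 set \<Rightarrow> 'a set" where
  "ideal_of \<equiv> module.span (*)"

definition minimally_generates :: "'a::comm_ring_1 set \<Rightarrow> 'a set \<Rightarrow> bool" where
  "minimally_generates G I \<longleftrightarrow> ideal_of G = I \<and> (\<forall>H. H \<subset> G \<longrightarrow> ideal_of H \<noteq> I)"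

definition monomial_order :: "('x monom \<Rightarrow> 'x monom \<Rightarrow> bool) \<Rightarrow> bool" where
  "monomial_order le \<longleftrightarrow>
    reflp le \<and> transp le \<and> antisymp le \<and> totalp le \<and>
    (\<forall>m. le 0 m) \<and> (\<forall>l m n. le m n \<longrightarrow> le (l + m) (l + n))"

text \<open>Only meaningful for nonzero polynomials.\<close>

definition lead_monom ::
  "('x monom \<Rightarrow> 'x monom \<Rightarrow> bool) \<Rightarrow> ('x, 'k::comm_ring_1) mpoly \<Rightarrow> 'x monom" where
  "lead_monom le p =
    (THE m. m \<in> Poly_Mapping.keys p \<and> (\<forall>n\<in>Poly_Mapping.keys p. le n m))"

definition initial_ideal ::
  "('x monom \<Rightarrow> 'x monom \<Rightarrow> bool) \<Rightarrow> ('x, 'k::comm_ring_1) mpoly set \<Rightarrow> ('x, 'k) mpoly set" where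
  "initial_ideal le F = ideal_of ((\<lambda>p. Monom (lead_monom le p)) ` (F - {0}))"

definition groebner_basis ::
  "('x monom \<Rightarrow> 'x monom \<Rightarrow> bool) \<Rightarrow> ('x, 'k::field) mpoly set \<Rightarrow> ('x, 'k) mpoly set \<Rightarrow> bool" where
  "groebner_basis le G I \<longleftrightarrow>
    finite G \<and> G \<subseteq> I \<and> initial_ideal le G = initial_ideal le I"

text \<open>Leading coefficients are not normalised: some of the polynomials below have leading
  coefficient 4.\<close>

definition minimal_groebner_basis ::
  "('x monom \<Rightarrow> 'x monom \<Rightarrow> bool) \<Rightarrow> ('x, 'k::field) mpoly set \<Rightarrow> ('x, 'k) mpoly set \<Rightarrow> bool" where
  "minimal_groebner_basis le G I \<longleftrightarrow>
    groebner_basis le G I \<and> 0 \<notin> G \<and>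
    (\<forall>p\<in>G. Monom (lead_monom le p) \<notin> initial_ideal le (G - {p}))"


section \<open>The Hirota variety of the simplex\<close>

text \<open>
  The indices \<open>1, \<dots>, g\<close> are the elements of a finite linearly ordered type \<open>'n\<close>, with
  \<open>g = CARD('n)\<close>.  The parameters \<open>\<kappa>\<^sub>0, \<kappa>\<^sub>1, \<dots>, \<kappa>\<^sub>g\<close> are indexed by \<open>'n option\<close>, with \<open>None\<close> in the
  role of \<open>0\<close>.
\<close>

datatype 'n coord = U 'n | V 'n | W 'n

fun weight :: "'n coord \<Rightarrow> nat" where
  "weight (U i) = 1"
| "weight (V i) = 2"
| "weight (W i) = 3"

definition weighted_degree :: "'n coord monom \<Rightarrow> nat" where
  "weighted_degree m = (\<Sum>x\<in>Poly_Mapping.keys m. weight x * Poly_Mapping.lookup m x)"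

definition weighted_homogeneous :: "nat \<Rightarrow> ('n coord, 'k::comm_ring_1) mpoly \<Rightarrow> bool" where
  "weighted_homogeneous d p \<longleftrightarrow> (\<forall>m\<in>Poly_Mapping.keys p. weighted_degree m = d)"

abbreviation kappa0 :: "('n option, 'k::comm_ring_1) mpoly" where
  "kappa0 \<equiv> Var None"

abbreviation kappa :: "'n \<Rightarrow> ('n option, 'k::comm_ring_1) mpoly" where
  "kappa j \<equiv> Var (Some j)"

fun parametrization :: "'n coord \<Rightarrow> ('n option, 'k::comm_ring_1) mpoly" where
  "parametrization (U j) = kappa j - kappa0"
| "parametrization (V j) = kappa j ^ 2 - kappa0 ^ 2"
| "parametrization (W j) = kappa j ^ 3 - kappa0 ^ 3"

definition simplex_ideal :: "('n coord, 'k::comm_ring_1) mpoly set" where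
  "simplex_ideal = {p. poly_subst parametrization p = 0}"

abbreviation u :: "'n \<Rightarrow> ('n coord, 'k::comm_ring_1) mpoly" where
  "u i \<equiv> Var (U i)"

abbreviation v :: "'n \<Rightarrow> ('n coord, 'k::comm_ring_1) mpoly" where
  "v i \<equiv> Var (V i)"

abbreviation w :: "'n \<Rightarrow> ('n coord, 'k::comm_ring_1) mpoly" where
  "w i \<equiv> Var (W i)"

definition cubic :: "'n \<Rightarrow> 'n \<Rightarrow> ('n coord, 'k::comm_ring_1) mpoly" where
  "cubic i j = v i * u j - v j * u i - u i * u j * (u i - u j)"

definition diag_quartic :: "'n \<Rightarrow> ('n coord, 'k::comm_ring_1) mpoly" where
  "diag_quartic i = 4 * w i * u i - 3 * v i ^ 2 - u i ^ 4"

definition quartic :: "'n \<Rightarrow> 'n \<Rightarrow> ('n coord, 'k::comm_ring_1) mpoly" where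
  "quartic i j = 4 * w j * u i - 3 * v i * v j + 3 * u i * (u i - u j) * v j - u i * u j ^ 3"

definition quintic :: "'n \<Rightarrow> 'n \<Rightarrow> ('n coord, 'k::comm_ring_1) mpoly" where
  "quintic i j = 4 * w i * v j - 4 * w j * v i + 3 * u i * v j * (v j - v i)
     + u i * v j * (u j - u i) * (u i - 2 * u j) + u i * u j ^ 3 * (u i - u j)"

definition cubics :: "('n::linorder coord, 'k::comm_ring_1) mpoly set" where
  "cubics = {cubic i j | i j. i < j}"

definition diag_quartics :: "('n coord, 'k::comm_ring_1) mpoly set" where
  "diag_quartics = {diag_quartic i | i. True}"

definition quartics :: "('n coord, 'k::comm_ring_1) mpoly set" where
  "quartics = {quartic i j | i j. i \<noteq> j}"

definition quintics :: "('n::linorder coord, 'k::comm_ring_1) mpoly set" where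
  "quintics = {quintic i j | i j. i < j}"

text \<open>The argument is the function assigning to a polynomial its leading monomial.\<close>

definition selects_underlined ::
  "(('n::linorder coord, 'k::comm_ring_1) mpoly \<Rightarrow> 'n coord monom) \<Rightarrow> bool" where
  "selects_underlined lm \<longleftrightarrow>
    (\<forall>i j. i < j \<longrightarrow> lm (cubic i j) = mvar (V i) + mvar (U j)) \<and>
    (\<forall>i. lm (diag_quartic i) = mvar (W i) + mvar (U i)) \<and>
    (\<forall>i j. i \<noteq> j \<longrightarrow> lm (quartic i j) = mvar (W j) + mvar (U i)) \<and>
    (\<forall>i j. i < j \<longrightarrow> lm (quintic i j) = mvar (W i) + mvar (V j))"

end

theory Submission
  imports Defs
begin

text \<open>
  Write \<open>\<kappa>\<^sub>0 = z\<close> and \<open>\<kappa>\<^sub>j = x\<^sub>j + z\<close>.  Then the parametrization becomes \<open>u\<^sub>j \<mapsto> x\<^sub>j\<close>,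
  \<open>v\<^sub>j \<mapsto> 2 x\<^sub>j z + x\<^sub>j\<^sup>2\<close>, \<open>w\<^sub>j \<mapsto> 3 x\<^sub>j z\<^sup>2 + 3 x\<^sub>j\<^sup>2 z + x\<^sub>j\<^sup>3\<close>, and the parts of highest degree in \<open>z\<close> are
  the terms \<open>x\<^sub>j\<close>, \<open>2 x\<^sub>j z\<close>, \<open>3 x\<^sub>j z\<^sup>2\<close>.  So a monomial in the \<open>u\<close>, \<open>v\<close>, \<open>w\<close> is sent to a nonzero
  multiple of a monomial in \<open>x\<close> and \<open>z\<close> plus terms of lower degree in \<open>z\<close>; that 2 and 3 are nonzero is where
  the characteristic enters.

  Call a monomial standard if it is divisible by none of the underlined monomials
  \<open>v\<^sub>i u\<^sub>j\<close> (\<open>i < j\<close>), \<open>w\<^sub>j u\<^sub>i\<close> (all \<open>i, j\<close>), \<open>w\<^sub>i v\<^sub>j\<close> (\<open>i < j\<close>).  List the variables of a standard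
  monomial by increasing index: either all \<open>u\<close> come before all \<open>v\<close> and there are no \<open>w\<close>, or all \<open>v\<close> come
  before all \<open>w\<close> and there are no \<open>u\<close>, where only one index can occur with both letters.  Hence it is determined by how often each index occurs,
  which is the exponent of \<open>x\<^sub>j\<close> in its highest term, together with the total exponent of \<open>z\<close>
  (lemma \<open>inj_on_staircase\<close>).  Distinct standard monomials thus have distinct highest terms, and so
  no nonzero element of the ideal is supported on standard monomials (lemma \<open>simplex_ideal_staircase\<close>).
  By division with remainder this makes the generators a Groebner basis, for every monomial order that
  selects the underlined monomials, and in particular a generating set (lemma \<open>groebner_basisI\<close>).
  The lexicographic order with
  \<open>w\<^sub>1 > \<dots> > w\<^sub>g > v\<^sub>1 > \<dots> > v\<^sub>g > u\<^sub>1 > \<dots> > u\<^sub>g\<close> is such an order.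

  For minimality, use the ordinary grading in which each variable has degree 1.  All terms of the generators
  have degree at least 2, the underlined monomials have degree 2, and each of them occurs in exactly one
  generator.  A linear combination with polynomial coefficients of the other generators therefore
  cannot contain that monomial (lemma \<open>ideal_coeff_eq_0\<close>), so no generator can be omitted.  The same
  lemma shows that no underlined monomial lies in the ideal generated by the others.
\<close>


section \<open>Division with remainder by a set of polynomials\<close>

abbreviation divides_monom :: "'x monom \<Rightarrow> 'x monom \<Rightarrow> bool" where
  "divides_monom m n \<equiv> \<forall>x. Poly_Mapping.lookup m x \<le> Poly_Mapping.lookup n x"

lemma divides_monom_cofactor:
  fixes m n :: "'x monom"
  assumes "divides_monom m n"
  obtains l where "n = l + m"
proof
  show "n = (n - m) + m"
    using assms by (intro poly_mapping_eqI) (simp add: lookup_add lookup_minus)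
qed

text \<open>A monotone subsequence exists in every linear order; a decreasing one is constant from its minimum on.\<close>
lemma mono_subsequence_nat:
  fixes s :: "nat \<Rightarrow> nat"
  obtains r :: "nat \<Rightarrow> nat" where "strict_mono r" "mono (s \<circ> r)"
proof -
  obtain r where r: "strict_mono r" "monoseq (s \<circ> r)"
    using seq_monosub[of s] by (auto simp: o_def)
  show ?thesis
  proof (cases "mono (s \<circ> r)")
    case True
    then show ?thesis using r that by blast
  next
    case False
    then have dec: "decseq (s \<circ> r)"
      using r by (simp add: monoseq_iff)
    have "\<exists>k. \<forall>n. s (r k) \<le> s (r n)"
      using ex_has_least_nat[of "\<lambda>_. True" 0 "\<lambda>n. s (r n)"] by auto
    then obtain k where k: "\<And>n. s (r k) \<le> s (r n)"
      by blast
    have const: "s (r (k + n)) = s (r k)" for n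
      using decseqD[OF dec, of k "k + n"] k[of "k + n"] by simp
    \<comment> \<open>by the choice of \<open>k\<close>, the sequence \<open>s \<circ> r\<close> is constant from \<open>k\<close> on\<close>
    have "strict_mono (r \<circ> (+) k)"
      using r by (simp add: strict_mono_def)
    moreover have "mono (s \<circ> (r \<circ> (+) k))"
      by (simp add: mono_def const)
    ultimately show ?thesis using that by blast
  qed
qed

text \<open>Dickson's lemma.  Passing to subsequences, one variable at a time, makes the exponents of all
  variables nondecreasing.\<close>
lemma dickson:
  fixes f :: "nat \<Rightarrow> 'x::finite monom"
  obtains i j where "i < j" "divides_monom (f i) (f j)"
proof -
  have "\<exists>r :: nat \<Rightarrow> nat. strict_mono r \<and> (\<forall>x\<in>S. mono (\<lambda>n. Poly_Mapping.lookup (f (r n)) x))"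
    if "finite S" for S :: "'x set"
    using that
  proof induction
    case empty
    show ?case by (intro exI[of _ id]) (simp add: strict_mono_def)
  next
    case (insert y S)
    then obtain r :: "nat \<Rightarrow> nat" where r: "strict_mono r"
      "\<forall>x\<in>S. mono (\<lambda>n. Poly_Mapping.lookup (f (r n)) x)" by blast
    obtain q :: "nat \<Rightarrow> nat" where q: "strict_mono q" "mono ((\<lambda>n. Poly_Mapping.lookup (f (r n)) y) \<circ> q)"
      by (rule mono_subsequence_nat[of "\<lambda>n. Poly_Mapping.lookup (f (r n)) y"])
    have "strict_mono (r \<circ> q)"
      using r q by (simp add: strict_mono_def)
    moreover have "mono (\<lambda>n. Poly_Mapping.lookup (f ((r \<circ> q) n)) x)" if "x \<in> insert y S" for x
    proof (cases "x = y")
      case False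
      then have "mono (\<lambda>n. Poly_Mapping.lookup (f (r n)) x)" using that r(2) by blast
      then show ?thesis using strict_mono_mono[OF q(1)] by (simp add: mono_def)
    qed (use q(2) in \<open>simp add: o_def\<close>)
    ultimately show ?case by blast
  qed
  from this[of UNIV] obtain r :: "nat \<Rightarrow> nat" where r: "strict_mono r"
    "\<forall>x. mono (\<lambda>n. Poly_Mapping.lookup (f (r n)) x)" by auto
  have "r 0 < r 1" using r(1) by (simp add: strict_mono_def)
  moreover have "divides_monom (f (r 0)) (f (r 1))"
    using r(2) by (simp add: mono_def)
  ultimately show ?thesis using that by blast
qed

locale monomial_ordering =
  fixes le :: "'x monom \<Rightarrow> 'x monom \<Rightarrow> bool"
  assumes monomial_order: "monomial_order le"
begin

lemma le_refl: "le m m"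
  using monomial_order by (simp add: monomial_order_def reflp_def)

lemma le_trans: "le l m \<Longrightarrow> le m n \<Longrightarrow> le l n"
  using monomial_order unfolding monomial_order_def by (blast dest: transpD)

lemma le_antisym: "le m n \<Longrightarrow> le n m \<Longrightarrow> m = n"
  using monomial_order unfolding monomial_order_def by (blast dest: antisympD)

lemma le_linear: "le m n \<or> le n m"
  using monomial_order le_refl unfolding monomial_order_def totalp_on_def by (metis UNIV_I)

lemma le_add_left: "le m n \<Longrightarrow> le (l + m) (l + n)"
  using monomial_order by (simp add: monomial_order_def)

lemma divides_monom_le:
  assumes "divides_monom m n"
  shows "le m n"
proof -
  obtain l where l: "n = l + m" using divides_monom_cofactor[OF assms] .
  have "le 0 l" using monomial_order by (simp add: monomial_order_def)
  from le_add_left[OF this, of m] show ?thesis by (simp add: l add.commute)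
qed

lemma lead_monom_eqI:
  assumes "m \<in> Poly_Mapping.keys p" "\<And>n. n \<in> Poly_Mapping.keys p \<Longrightarrow> le n m"
  shows "lead_monom le p = m"
  unfolding lead_monom_def using assms le_antisym by (intro the_equality) auto

lemma ex_greatest: "finite M \<Longrightarrow> M \<noteq> {} \<Longrightarrow> \<exists>m\<in>M. \<forall>n\<in>M. le n m"
proof (induction M rule: finite_ne_induct)
  case (insert k M)
  then obtain m where m: "m \<in> M" "\<forall>n\<in>M. le n m" by blast
  show ?case
  proof (cases "le k m")
    case False
    then have "le m k" using le_linear by blast
    then show ?thesis using m le_refl le_trans by blast
  qed (use m in auto)
qed (simp add: le_refl)

lemma
  assumes "p \<noteq> 0"
  shows lead_monom_in_keys: "lead_monom le p \<in> Poly_Mapping.keys p"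
    and le_lead_monom: "n \<in> Poly_Mapping.keys p \<Longrightarrow> le n (lead_monom le p)"
proof -
  obtain m where m: "m \<in> Poly_Mapping.keys p" "\<forall>n\<in>Poly_Mapping.keys p. le n m"
    using ex_greatest[of "Poly_Mapping.keys p"] assms by auto
  then have "lead_monom le p = m" by (blast intro: lead_monom_eqI)
  with m show "lead_monom le p \<in> Poly_Mapping.keys p"
    "n \<in> Poly_Mapping.keys p \<Longrightarrow> le n (lead_monom le p)" by auto
qed

definition standard_monomials :: "('x, 'k::comm_ring_1) mpoly set \<Rightarrow> 'x monom set" where
  "standard_monomials G = {m. \<forall>p\<in>G. \<forall>l. m \<noteq> l + lead_monom le p}"

end

text \<open>A monomial order extends divisibility, so by Dickson's lemma an infinite descending chain would
  contain two members in ascending order.  This is what makes division terminate.\<close>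
lemma wf_monomial_order:
  fixes le :: "'x::finite monom \<Rightarrow> 'x monom \<Rightarrow> bool"
  assumes "monomial_order le"
  shows "wf {(m, n). le m n \<and> m \<noteq> n}"
proof -
  interpret monomial_ordering le by unfold_locales (rule assms)
  show ?thesis
    unfolding wf_iff_no_infinite_down_chain
  proof
    assume "\<exists>f. \<forall>i. (f (Suc i), f i) \<in> {(m, n). le m n \<and> m \<noteq> n}"
    then obtain f where f: "\<And>i. le (f (Suc i)) (f i)" "\<And>i. f (Suc i) \<noteq> f i" by auto
    have desc: "le (f (i + k)) (f i)" for i k
      by (induction k) (auto simp: le_refl intro: le_trans f)
    obtain i j where ij: "i < j" "divides_monom (f i) (f j)" by (rule dickson)
    have "le (f j) (f (Suc i))" using desc[of "Suc i" "j - Suc i"] ij by simp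
    with divides_monom_le[OF ij(2)] have "le (f i) (f (Suc i))" by (rule le_trans)
    with f le_antisym show False by metis
  qed
qed

lemma mpoly_single_eq: "Poly_Mapping.single m c = Const c * Monom m"
  by (simp add: Const_def Monom_def mult_single)

lemma keys_diff_subset_Un: "Poly_Mapping.keys (p - q) \<subseteq> Poly_Mapping.keys p \<union> Poly_Mapping.keys q"
  for p q :: "'a \<Rightarrow>\<^sub>0 'b::ab_group_add"
  by (auto simp: in_keys_iff lookup_minus)

lemma keys_sum_subset_Union: "Poly_Mapping.keys (sum f A) \<subseteq> (\<Union>a\<in>A. Poly_Mapping.keys (f a))"
  for f :: "'c \<Rightarrow> 'a \<Rightarrow>\<^sub>0 'b::comm_monoid_add"
  by (induction A rule: infinite_finite_induct) (use keys_add in fastforce)+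

lemma keys_single_mult:
  fixes p :: "('x, 'k::comm_ring_1) mpoly"
  shows "Poly_Mapping.keys (Poly_Mapping.single m c * p) \<subseteq> (+) m ` Poly_Mapping.keys p"
  using keys_mult[of "Poly_Mapping.single m c" p] by (auto split: if_splits)

text \<open>Division with remainder.  A monomial divisible by the leading monomial of some \<open>q \<in> G\<close> is congruent to a
  combination of smaller monomials, by subtracting a multiple of \<open>q\<close>; well-founded induction
  on the monomial order and linearity do the rest.  That the remainder involves no monomial
  larger than those of \<open>p\<close> is what later preserves leading monomials.\<close>
lemma ex_normal_form:
  fixes G :: "('x::finite, 'k::field) mpoly set"
  assumes "monomial_order le" and "0 \<notin> G"
  shows "\<exists>r. p - r \<in> ideal_of G \<and> Poly_Mapping.keys r \<subseteq> monomial_ordering.standard_monomials le G \<and>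
    (\<forall>n\<in>Poly_Mapping.keys r. \<exists>m\<in>Poly_Mapping.keys p. le n m)"
proof -
  interpret monomial_ordering le by unfold_locales fact
  interpret ideal: module "(*) :: ('x, 'k) mpoly \<Rightarrow> ('x, 'k) mpoly \<Rightarrow> ('x, 'k) mpoly"
    by (rule module_times)
  let ?N = "standard_monomials G"
  \<comment> \<open>linearity: remainders of the monomials of \<open>p\<close> add up to a remainder of \<open>p\<close>\<close>
  have combine: "\<exists>r. p - r \<in> ideal_of G \<and> Poly_Mapping.keys r \<subseteq> ?N \<and>
      (\<forall>n\<in>Poly_Mapping.keys r. \<exists>m\<in>Poly_Mapping.keys p. le n m)"
    if "\<And>m. m \<in> Poly_Mapping.keys p \<Longrightarrow>
      \<exists>r. Monom m - r \<in> ideal_of G \<and> Poly_Mapping.keys r \<subseteq> ?N \<and> (\<forall>n\<in>Poly_Mapping.keys r. le n m)"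
    for p :: "('x, 'k) mpoly"
  proof -
    obtain R where R: "Monom m - R m \<in> ideal_of G" "Poly_Mapping.keys (R m) \<subseteq> ?N"
      "\<forall>n\<in>Poly_Mapping.keys (R m). le n m" if "m \<in> Poly_Mapping.keys p" for m
      using \<open>\<And>m. m \<in> Poly_Mapping.keys p \<Longrightarrow> _ m\<close> by metis
    let ?c = "\<lambda>m. Const (Poly_Mapping.lookup p m) :: ('x, 'k) mpoly"
    let ?r = "\<Sum>m\<in>Poly_Mapping.keys p. ?c m * R m"
    have "p = (\<Sum>m\<in>Poly_Mapping.keys p. ?c m * Monom m)"
      using mpoly_eq_sum_single[of p] by (simp add: mpoly_single_eq)
    then have "p - ?r = (\<Sum>m\<in>Poly_Mapping.keys p. ?c m * (Monom m - R m))"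
      by (simp add: right_diff_distrib sum_subtractf)
    also have "\<dots> \<in> ideal_of G"
      using R by (intro ideal.span_sum ideal.span_scale)
    finally have "p - ?r \<in> ideal_of G" .
    moreover have "Poly_Mapping.keys ?r \<subseteq> (\<Union>m\<in>Poly_Mapping.keys p. Poly_Mapping.keys (R m))"
    proof -
      have "Poly_Mapping.keys (?c m * R m) \<subseteq> Poly_Mapping.keys (R m)" for m
        using keys_single_mult[of 0 "Poly_Mapping.lookup p m" "R m"] by (simp add: Const_def)
      then show ?thesis by (intro subset_trans[OF keys_sum_subset_Union] UN_mono) simp_all
    qed
    ultimately show ?thesis using R by (intro exI[of _ ?r]) blast
  qed
  have monom: "\<exists>r. (Monom m :: ('x, 'k) mpoly) - r \<in> ideal_of G \<and> Poly_Mapping.keys r \<subseteq> ?N \<and>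
      (\<forall>n\<in>Poly_Mapping.keys r. le n m)" for m
    using wf_monomial_order[OF assms(1)]
  proof (induction m rule: wf_induct_rule)
    case (less m)
    show ?case
    proof (cases "m \<in> ?N")
      case True
      then show ?thesis
        by (intro exI[of _ "Monom m"]) (simp add: ideal.span_zero Monom_def le_refl)
    next
      case False
      then obtain q l where q: "q \<in> G" and m: "m = l + lead_monom le q"
        by (auto simp: standard_monomials_def)
      have q0: "q \<noteq> 0" using q assms by auto
      define c where "c = Poly_Mapping.lookup q (lead_monom le q)"
      have c: "c \<noteq> 0"
        using lead_monom_in_keys[OF q0] by (simp add: c_def in_keys_iff)
      define s where "s = Poly_Mapping.single l (inverse c)"
      define p where "p = Monom m - s * q"
      have keys_p: "le n m \<and> n \<noteq> m" if n: "n \<in> Poly_Mapping.keys p" for n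
      proof -
        have lead: "Poly_Mapping.lookup (s * q) m = 1"
        proof -
          have "s * q = (\<Sum>k\<in>Poly_Mapping.keys q.
              Poly_Mapping.single (l + k) (inverse c * Poly_Mapping.lookup q k))"
            using arg_cong[OF mpoly_eq_sum_single[of q], of "(*) s"]
            by (simp add: s_def sum_distrib_left mult_single)
          then have "Poly_Mapping.lookup (s * q) m = (\<Sum>k\<in>Poly_Mapping.keys q.
              if k = lead_monom le q then inverse c * Poly_Mapping.lookup q k else 0)"
            by (simp add: lookup_sum lookup_single m when_def)
          then show ?thesis
            using lead_monom_in_keys[OF q0] c by (simp add: c_def)
        qed
        then have "Poly_Mapping.lookup p m = 0"
          by (simp add: p_def lookup_minus Monom_def)
        with n have "n \<noteq> m" by (auto simp: in_keys_iff)
        moreover have "n \<in> insert m ((+) l ` Poly_Mapping.keys q)"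
          using n keys_diff_subset_Un[of "Monom m" "s * q"] keys_single_mult[of l "inverse c" q]
          by (auto simp: p_def s_def Monom_def)
        then have "le n m"
          using le_lead_monom[OF q0] le_add_left le_refl by (auto simp: m)
        ultimately show ?thesis by simp
      qed
      have "\<exists>r. p - r \<in> ideal_of G \<and> Poly_Mapping.keys r \<subseteq> ?N \<and>
          (\<forall>n\<in>Poly_Mapping.keys r. \<exists>m\<in>Poly_Mapping.keys p. le n m)"
        by (intro combine less.IH) (simp add: keys_p)
      then obtain r where r: "p - r \<in> ideal_of G" "Poly_Mapping.keys r \<subseteq> ?N"
        "\<forall>n\<in>Poly_Mapping.keys r. \<exists>m\<in>Poly_Mapping.keys p. le n m" by blast
      have "(p - r) + s * q \<in> ideal_of G"
        by (intro ideal.span_add ideal.span_scale r(1) ideal.span_base[OF q])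
      then have "Monom m - r \<in> ideal_of G" by (simp add: p_def)
      then show ?thesis using r keys_p le_trans by blast
    qed
  qed
  show ?thesis by (intro combine monom)
qed

text \<open>If the leading monomial of some \<open>p \<in> I\<close> were standard, dividing only the rest of \<open>p\<close> would give an
  element of \<open>I\<close> supported on standard monomials that still has this leading monomial.  So independence
  of the standard monomials modulo \<open>I\<close> suffices, without computing S-polynomials.\<close>
lemma groebner_basisI:
  fixes G I :: "('x::finite, 'k::field) mpoly set"
  assumes le: "monomial_order le" and G: "finite G" "0 \<notin> G" "G \<subseteq> I"
    and I: "module.subspace (*) I"
    and independent: "\<And>p. p \<in> I \<Longrightarrow>
      Poly_Mapping.keys p \<subseteq> monomial_ordering.standard_monomials le G \<Longrightarrow> p = 0"
  shows "ideal_of G = I" "groebner_basis le G I"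
proof -
  interpret monomial_ordering le by unfold_locales fact
  interpret ideal: module "(*) :: ('x, 'k) mpoly \<Rightarrow> ('x, 'k) mpoly \<Rightarrow> ('x, 'k) mpoly"
    by (rule module_times)
  have sub: "ideal_of G \<subseteq> I"
    using G(3) I by (rule ideal.span_minimal)
  have "p \<in> ideal_of G" if p: "p \<in> I" for p
  proof -
    obtain r where r: "p - r \<in> ideal_of G" "Poly_Mapping.keys r \<subseteq> standard_monomials G"
      using ex_normal_form[OF le G(2)] by blast
    have "r = p - (p - r)" by simp
    then have "r \<in> I" using ideal.subspace_diff[OF I p] r sub by (metis subsetD)
    then have "r = 0" using r independent by blast
    then show ?thesis using r by simp
  qed
  with sub show "ideal_of G = I" by blast
  have "Monom (lead_monom le p) \<in> initial_ideal le G" if p: "p \<in> I" "p \<noteq> 0" for p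
  proof -
    let ?m = "lead_monom le p"
    have "?m \<notin> standard_monomials G"
    proof
      assume std: "?m \<in> standard_monomials G"
      define t where "t = p - Poly_Mapping.single ?m (Poly_Mapping.lookup p ?m)"
      have t: "le n ?m \<and> n \<noteq> ?m" if "n \<in> Poly_Mapping.keys t" for n
        using that le_lead_monom[OF p(2), of n]
        by (auto simp: t_def in_keys_iff lookup_minus lookup_single when_def split: if_splits)
      obtain r where r: "t - r \<in> ideal_of G" "Poly_Mapping.keys r \<subseteq> standard_monomials G"
        "\<forall>n\<in>Poly_Mapping.keys r. \<exists>m\<in>Poly_Mapping.keys t. le n m"
        using ex_normal_form[OF le G(2)] by blast
      define s where "s = Poly_Mapping.single ?m (Poly_Mapping.lookup p ?m) + r"
      have "s = p - (t - r)" by (simp add: s_def t_def)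
      then have "s \<in> I" using ideal.subspace_diff[OF I p(1)] r sub by (metis subsetD)
      moreover have "Poly_Mapping.keys s \<subseteq> standard_monomials G"
        using keys_add[of "Poly_Mapping.single ?m (Poly_Mapping.lookup p ?m)" r] r(2) std
        by (auto simp: s_def split: if_splits)
      ultimately have "s = 0" by (rule independent)
      moreover have "?m \<notin> Poly_Mapping.keys r" using r(3) t le_antisym by blast
      then have "Poly_Mapping.lookup s ?m = Poly_Mapping.lookup p ?m"
        by (simp add: s_def lookup_add in_keys_iff)
      ultimately show False using lead_monom_in_keys[OF p(2)] by (simp add: in_keys_iff)
    qed
    then obtain q l where q: "q \<in> G" "?m = l + lead_monom le q"
      by (auto simp: standard_monomials_def)
    then have "Monom ?m = Monom l * (Monom (lead_monom le q) :: ('x, 'k) mpoly)"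
      by (simp add: Monom_def mult_single)
    also have "\<dots> \<in> initial_ideal le G"
      unfolding initial_ideal_def using q G(2)
      by (intro ideal.span_scale ideal.span_base imageI) auto
    finally show ?thesis .
  qed
  then have "initial_ideal le I \<subseteq> initial_ideal le G"
    unfolding initial_ideal_def[of le I]
    by (intro ideal.span_minimal) (auto simp: initial_ideal_def)
  moreover have "initial_ideal le G \<subseteq> initial_ideal le I"
    unfolding initial_ideal_def using G by (intro ideal.span_mono) auto
  ultimately show "groebner_basis le G I"
    using G by (auto simp: groebner_basis_def)
qed


section \<open>Linear independence by highest terms\<close>

text \<open>The term \<open>c t\<close> is the part of highest degree in the variable \<open>z\<close>.  As \<open>c = 0\<close> is permitted,
  highest terms are multiplicative over every commutative ring.\<close>
definition has_top_term :: "'y \<Rightarrow> 'y monom \<Rightarrow> 'k \<Rightarrow> ('y, 'k::comm_ring_1) mpoly \<Rightarrow> bool" where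
  "has_top_term z t c q \<longleftrightarrow>
    (\<forall>n\<in>Poly_Mapping.keys (q - Poly_Mapping.single t c). Poly_Mapping.lookup n z < Poly_Mapping.lookup t z)"

lemma has_top_term_1: "has_top_term z 0 1 1"
  by (simp add: has_top_term_def)

lemma has_top_term_keys:
  assumes "has_top_term z t c q" "n \<in> Poly_Mapping.keys q"
  shows "n = t \<or> Poly_Mapping.lookup n z < Poly_Mapping.lookup t z"
proof (cases "n = t")
  case False
  then have "n \<in> Poly_Mapping.keys (q - Poly_Mapping.single t c)"
    using assms(2) by (simp add: in_keys_iff lookup_minus lookup_single_not_eq)
  then show ?thesis using assms(1) by (simp add: has_top_term_def)
qed simp

lemma has_top_term_mult:
  assumes p: "has_top_term z s b p" and q: "has_top_term z t c q"
  shows "has_top_term z (s + t) (b * c) (p * q)"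
  unfolding has_top_term_def
proof
  let ?s = "Poly_Mapping.single s b" and ?t = "Poly_Mapping.single t c"
  fix n assume n: "n \<in> Poly_Mapping.keys (p * q - Poly_Mapping.single (s + t) (b * c))"
  have "p * q - Poly_Mapping.single (s + t) (b * c) = (p - ?s) * q + ?s * (q - ?t)"
    by (simp add: algebra_simps mult_single)
  with n have "n \<in> Poly_Mapping.keys ((p - ?s) * q) \<union> Poly_Mapping.keys (?s * (q - ?t))"
    using keys_add by (metis subsetD)
  then consider k l where "n = k + l" "k \<in> Poly_Mapping.keys (p - ?s)" "l \<in> Poly_Mapping.keys q"
    | l where "n = s + l" "l \<in> Poly_Mapping.keys (q - ?t)"
    using keys_mult[of "p - ?s" q] keys_single_mult[of s b "q - ?t"] by blast
  then show "Poly_Mapping.lookup n z < Poly_Mapping.lookup (s + t) z"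
  proof cases
    case 1
    then show ?thesis using p has_top_term_keys[OF q 1(3)]
      by (force simp: has_top_term_def lookup_add)
  next
    case 2
    then show ?thesis using q by (force simp: has_top_term_def lookup_add)
  qed
qed

lemma has_top_term_power:
  assumes "has_top_term z t c q"
  shows "has_top_term z (\<Sum>i<k. t) (c ^ k) (q ^ k)"
  by (induction k) (auto simp: has_top_term_1 add.commute intro!: has_top_term_mult[OF assms])

lemma has_top_term_prod:
  assumes "\<And>x. x \<in> S \<Longrightarrow> has_top_term z (t x) (c x) (q x)"
  shows "has_top_term z (\<Sum>x\<in>S. t x) (\<Prod>x\<in>S. c x) (\<Prod>x\<in>S. q x)"
  using assms
  by (induction S rule: infinite_finite_induct) (auto simp: has_top_term_1 intro!: has_top_term_mult)

text \<open>The multiplicative map of monomials given by the images of the variables; monomials being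
  written additively, powers are repeated sums.\<close>
definition monom_map :: "('x::finite \<Rightarrow> 'y monom) \<Rightarrow> 'x monom \<Rightarrow> 'y monom" where
  "monom_map t m = (\<Sum>x\<in>UNIV. \<Sum>i<Poly_Mapping.lookup m x. t x)"

lemma lookup_monom_map:
  "Poly_Mapping.lookup (monom_map t m) y = (\<Sum>x\<in>UNIV. Poly_Mapping.lookup m x * Poly_Mapping.lookup (t x) y)"
  by (simp add: monom_map_def lookup_sum)

text \<open>If the highest terms of the images of the monomials in \<open>S\<close> are pairwise not proportional, these images
  are linearly independent: among the monomials of \<open>p\<close> choose one whose image has the greatest degree in
  \<open>z\<close>; then the highest term of this image cannot cancel.\<close>
lemma poly_subst_eq_0_imp:
  fixes p :: "('x::finite, 'k::field) mpoly"
  assumes top: "\<And>x. has_top_term z (t x) (c x) (f x)" and c: "\<And>x. c x \<noteq> 0"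
    and inj: "inj_on (monom_map t) S" and keys: "Poly_Mapping.keys p \<subseteq> S"
    and p: "poly_subst f p = 0"
  shows "p = 0"
proof (rule ccontr)
  assume "p \<noteq> 0"
  let ?T = "monom_map t" and ?F = "\<lambda>m. \<Prod>x\<in>Poly_Mapping.keys m. f x ^ Poly_Mapping.lookup m x"
  define d where "d m = (\<Prod>x\<in>UNIV. c x ^ Poly_Mapping.lookup m x)" for m
  have F: "has_top_term z (?T m) (d m) (?F m)" for m
    unfolding d_def monom_map_def monom_prod_superset[OF finite subset_UNIV]
    by (intro has_top_term_prod has_top_term_power top)
  have "Max ((\<lambda>m. Poly_Mapping.lookup (?T m) z) ` Poly_Mapping.keys p)
      \<in> (\<lambda>m. Poly_Mapping.lookup (?T m) z) ` Poly_Mapping.keys p"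
    using \<open>p \<noteq> 0\<close> by (intro Max_in) auto
  then obtain m0 where m0: "m0 \<in> Poly_Mapping.keys p"
    "\<And>m. m \<in> Poly_Mapping.keys p \<Longrightarrow> Poly_Mapping.lookup (?T m) z \<le> Poly_Mapping.lookup (?T m0) z"
    using Max_ge[of "(\<lambda>m. Poly_Mapping.lookup (?T m) z) ` Poly_Mapping.keys p"] by fastforce
  have coeff: "Poly_Mapping.lookup (?F m) (?T m0) = (if m = m0 then d m0 else 0)"
    if m: "m \<in> Poly_Mapping.keys p" for m
  proof -
    have "?T m0 \<notin> Poly_Mapping.keys (?F m - Poly_Mapping.single (?T m) (d m))"
      using F[of m] m0(2)[OF m] by (auto simp: has_top_term_def)
    then have "Poly_Mapping.lookup (?F m) (?T m0) = (d m when ?T m = ?T m0)"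
      by (simp add: in_keys_iff lookup_minus lookup_single)
    then show ?thesis
      using inj_onD[OF inj, of m m0] m m0(1) keys by (auto simp: when_def)
  qed
  have scale: "Poly_Mapping.lookup (Const a * q) n = a * Poly_Mapping.lookup q n"
    for a and q :: "('y, 'k) mpoly" and n
    unfolding Const_def
    using arg_cong[OF mult_map_scale_conv_mult[of a q], of "\<lambda>r. Poly_Mapping.lookup r n"]
    by (simp add: map.rep_eq when_def split: if_splits)
  have "0 = Poly_Mapping.lookup (poly_subst f p) (?T m0)" using p by simp
  also have "\<dots> = (\<Sum>m\<in>Poly_Mapping.keys p.
      Poly_Mapping.lookup p m * Poly_Mapping.lookup (?F m) (?T m0))"
    by (simp add: poly_subst_def lookup_sum scale)
  also have "\<dots> = (\<Sum>m\<in>Poly_Mapping.keys p.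
      if m = m0 then Poly_Mapping.lookup p m0 * d m0 else 0)"
    by (intro sum.cong) (auto simp: coeff)
  also have "\<dots> = Poly_Mapping.lookup p m0 * d m0"
    using m0(1) by simp
  finally show False
    using m0(1) c by (simp add: d_def in_keys_iff)
qed


section \<open>Coefficients at monomials of lowest degree\<close>

text \<open>The ordinary degree, as opposed to the weighted one: for it all the underlined monomials are of
  the lowest degree in their polynomials.\<close>
definition total_degree :: "'x::finite monom \<Rightarrow> nat" where
  "total_degree m = (\<Sum>x\<in>UNIV. Poly_Mapping.lookup m x)"

lemma total_degree_add: "total_degree (m + n) = total_degree m + total_degree n"
  by (simp add: total_degree_def lookup_add sum.distrib)

lemma total_degree_eq_0_iff: "total_degree m = 0 \<longleftrightarrow> m = 0"
  by (auto simp: total_degree_def intro!: poly_mapping_eqI)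

lemma total_degree_mvar: "total_degree (mvar x) = 1"
  by (simp add: total_degree_def mvar_def lookup_single when_def)

text \<open>If \<open>m\<close> has the lowest degree occurring in \<open>F\<close>, then multiplying by a polynomial affects the coefficient of
  \<open>m\<close> only through its constant term.  So if \<open>m\<close> is missing from \<open>F\<close>, it is missing from the whole ideal.\<close>
lemma ideal_coeff_eq_0:
  fixes F :: "('x::finite, 'k::comm_ring_1) mpoly set"
  assumes F: "\<And>q. q \<in> F \<Longrightarrow> Poly_Mapping.lookup q m = 0"
      "\<And>q n. q \<in> F \<Longrightarrow> n \<in> Poly_Mapping.keys q \<Longrightarrow> total_degree m \<le> total_degree n"
    and p: "p \<in> ideal_of F"
  shows "Poly_Mapping.lookup p m = 0"
proof -
  interpret ideal: module "(*) :: ('x, 'k) mpoly \<Rightarrow> ('x, 'k) mpoly \<Rightarrow> ('x, 'k) mpoly"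
    by (rule module_times)
  let ?J = "{q. \<forall>n\<in>Poly_Mapping.keys q. total_degree m \<le> total_degree n \<and> n \<noteq> m}
    :: ('x, 'k) mpoly set"
  have "ideal.subspace ?J"
  proof (rule ideal.subspaceI)
    fix h q :: "('x, 'k) mpoly" assume q: "q \<in> ?J"
    show "h * q \<in> ?J"
    proof (clarify, rule conjI)
      fix n assume "n \<in> Poly_Mapping.keys (h * q)"
      then obtain k l where kl: "n = k + l" "l \<in> Poly_Mapping.keys q"
        using keys_mult[of h q] by blast
      with q have l: "total_degree m \<le> total_degree l" "l \<noteq> m" by auto
      then show "total_degree m \<le> total_degree n" by (simp add: kl total_degree_add)
      show "n \<noteq> m"
      proof
        assume "n = m"
        then have "total_degree m = total_degree k + total_degree l"
          using kl(1) total_degree_add by blast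
        with l(1) have "k = 0" by (simp flip: total_degree_eq_0_iff)
        then show False using l kl \<open>n = m\<close> by simp
      qed
    qed
  qed (auto dest: subsetD[OF keys_add])
  moreover have "F \<subseteq> ?J"
  proof clarify
    fix q n assume "q \<in> F" "n \<in> Poly_Mapping.keys q"
    then show "total_degree m \<le> total_degree n \<and> n \<noteq> m"
      using F by (metis in_keys_iff)
  qed
  ultimately have "p \<in> ?J" using p ideal.span_minimal by blast
  then show ?thesis by (auto simp: in_keys_iff)
qed


section \<open>The generators\<close>

text \<open>The smallest variable in this order is the most significant one in the lexicographic order of
  monomials.  So \<open>w\<^sub>1, \<dots>, w\<^sub>g\<close> come first, followed by \<open>v\<^sub>1, \<dots>, v\<^sub>g\<close> and by \<open>u\<^sub>1, \<dots>, u\<^sub>g\<close>.\<close>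
instantiation coord :: (linorder) linorder
begin

fun less_coord :: "'a coord \<Rightarrow> 'a coord \<Rightarrow> bool" where
  "less_coord (W i) (W j) = (i < j)"
| "less_coord (W i) y = True"
| "less_coord (V i) (W j) = False"
| "less_coord (V i) (V j) = (i < j)"
| "less_coord (V i) (U j) = True"
| "less_coord (U i) (U j) = (i < j)"
| "less_coord (U i) y = False"

definition less_eq_coord :: "'a coord \<Rightarrow> 'a coord \<Rightarrow> bool" where
  "less_eq_coord x y \<longleftrightarrow> x < y \<or> x = y"

instance
proof
  fix x y z :: "'a coord"
  show "x < y \<longleftrightarrow> x \<le> y \<and> \<not> y \<le> x"
    by (cases x; cases y) (auto simp: less_eq_coord_def)
  show "x \<le> x" by (simp add: less_eq_coord_def)
  show "x \<le> y \<Longrightarrow> y \<le> z \<Longrightarrow> x \<le> z"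
    by (cases x; cases y; cases z) (auto simp: less_eq_coord_def)
  show "x \<le> y \<Longrightarrow> y \<le> x \<Longrightarrow> x = y"
    by (cases x; cases y) (auto simp: less_eq_coord_def)
  show "x \<le> y \<or> y \<le> x"
    by (cases x; cases y) (auto simp: less_eq_coord_def)
qed

end

lemma UNIV_coord: "(UNIV :: 'n coord set) = range U \<union> range V \<union> range W"
proof -
  have "x \<in> range U \<union> range V \<union> range W" for x :: "'n coord"
    by (cases x) auto
  then show ?thesis by blast
qed

instance coord :: (finite) finite
proof
  show "finite (UNIV :: 'a coord set)" unfolding UNIV_coord by simp
qed

lemma sum_coord:
  fixes h :: "'n::finite coord \<Rightarrow> 'a::comm_monoid_add"
  shows "(\<Sum>x\<in>UNIV. h x) = (\<Sum>i\<in>UNIV. h (U i)) + (\<Sum>i\<in>UNIV. h (V i)) + (\<Sum>i\<in>UNIV. h (W i))"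
proof -
  have "inj (U :: 'n \<Rightarrow> _)" "inj (V :: 'n \<Rightarrow> _)" "inj (W :: 'n \<Rightarrow> _)"
    by (auto simp: inj_def)
  moreover have "(\<Sum>x\<in>UNIV. h x) = sum h (range U) + sum h (range V) + sum h (range W)"
    unfolding UNIV_coord by (subst sum.union_disjoint; auto)+
  ultimately show ?thesis by (simp add: sum.reindex)
qed

text \<open>The underlined monomials are products of two distinct variables, and such pairs of variables serve as
  names for the generators.  As \<open>quartic i i = diag_quartic i\<close>, the two families of quartics become one.\<close>
fun generator :: "'n coord \<times> 'n coord \<Rightarrow> ('n coord, 'k::comm_ring_1) mpoly" where
  "generator (V i, U j) = cubic i j"
| "generator (W j, U i) = quartic i j"
| "generator (W i, V j) = quintic i j"
| "generator _ = 0"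

definition lead_pairs :: "('n::linorder coord \<times> 'n coord) set" where
  "lead_pairs = {(V i, U j) | i j. i < j} \<union> {(W j, U i) | i j. True} \<union> {(W i, V j) | i j. i < j}"

definition lead_of :: "'n coord \<times> 'n coord \<Rightarrow> 'n coord monom" where
  "lead_of e = mvar (fst e) + mvar (snd e)"

lemma quartic_diag: "quartic i i = diag_quartic i"
  by (simp add: quartic_def diag_quartic_def algebra_simps eval_nat_numeral)

abbreviation cmonom :: "'k \<Rightarrow> 'x monom \<Rightarrow> ('x, 'k::comm_ring_1) mpoly" where
  "cmonom c m \<equiv> Poly_Mapping.single m c"

text \<open>Read from left to right, these equations turn the expansions below into identities
  of commutative rings.\<close>
lemma cmonom_mvar:
  "cmonom 1 (mvar x) = Var x"
  "cmonom (numeral k) (mvar x) = numeral k * Var x"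
  "cmonom c (m + mvar x) = cmonom c m * Var x"
proof -
  show "cmonom 1 (mvar x) = Var x" by (simp add: Var_def Monom_def)
  show "cmonom c (m + mvar x) = cmonom c m * Var x"
    by (simp add: Var_def Monom_def mult_single)
  have "cmonom (numeral k) (mvar x) = cmonom (numeral k) 0 * Var x"
    unfolding Var_def Monom_def mult_single by simp
  then show "cmonom (numeral k) (mvar x) = numeral k * Var x" by simp
qed

lemma cubic_expand:
  "cubic i j = cmonom 1 (mvar (V i) + mvar (U j)) - cmonom 1 (mvar (V j) + mvar (U i))
    - cmonom 1 (mvar (U i) + mvar (U i) + mvar (U j)) + cmonom 1 (mvar (U i) + mvar (U j) + mvar (U j))"
  unfolding cubic_def cmonom_mvar by (simp add: algebra_simps power3_eq_cube)

lemma quartic_expand: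
  "quartic i j = cmonom 4 (mvar (W j) + mvar (U i)) - cmonom 3 (mvar (V i) + mvar (V j))
    + cmonom 3 (mvar (U i) + mvar (U i) + mvar (V j)) - cmonom 3 (mvar (U i) + mvar (U j) + mvar (V j))
    - cmonom 1 (mvar (U i) + mvar (U j) + mvar (U j) + mvar (U j))"
  unfolding quartic_def cmonom_mvar by (simp add: algebra_simps power3_eq_cube)

lemma quintic_expand:
  "quintic i j = cmonom 4 (mvar (W i) + mvar (V j)) - cmonom 4 (mvar (W j) + mvar (V i))
    + cmonom 3 (mvar (U i) + mvar (V j) + mvar (V j)) - cmonom 3 (mvar (U i) + mvar (V i) + mvar (V j))
    + cmonom 3 (mvar (U i) + mvar (U i) + mvar (U j) + mvar (V j))
    - cmonom 2 (mvar (U i) + mvar (U j) + mvar (U j) + mvar (V j))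
    - cmonom 1 (mvar (U i) + mvar (U i) + mvar (U i) + mvar (V j))
    + cmonom 1 (mvar (U i) + mvar (U i) + mvar (U j) + mvar (U j) + mvar (U j))
    - cmonom 1 (mvar (U i) + mvar (U j) + mvar (U j) + mvar (U j) + mvar (U j))"
  unfolding quintic_def cmonom_mvar by (simp add: algebra_simps power3_eq_cube)

lemma mvar_add_eq_iff: "mvar x + mvar y = mvar x' + mvar y' \<longleftrightarrow> (x = x' \<and> y = y') \<or> (x = y' \<and> y = x')"
proof
  assume *: "mvar x + mvar y = mvar x' + mvar y'"
  have "(1 when x = z) + (1 when y = z) = (1 when x' = z) + (1 when y' = z :: nat)" for z
    using arg_cong[OF *, of "\<lambda>m. Poly_Mapping.lookup m z"]
    by (simp add: lookup_add mvar_def lookup_single)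
  from this[of x] this[of y] show "(x = x' \<and> y = y') \<or> (x = y' \<and> y = x')"
    by (auto simp: when_def split: if_splits)
qed (auto simp: add.commute)

lemma lead_pairs_cases:
  assumes "e \<in> lead_pairs"
  obtains i j where "i < j" "e = (V i, U j)" | i j where "e = (W j, U i)"
    | i j where "i < j" "e = (W i, V j)"
  using assms by (auto simp: lead_pairs_def)

lemma inj_on_lead_of: "inj_on lead_of lead_pairs"
  by (rule inj_onI) (auto simp: lead_of_def lead_pairs_def mvar_add_eq_iff)

lemma total_degree_lead_of: "total_degree (lead_of e) = 2"
  by (simp add: lead_of_def total_degree_add total_degree_mvar)

lemma lookup_single_lead_of:
  "Poly_Mapping.lookup (Poly_Mapping.single m c) (lead_of e)
    = (if total_degree m = 2 then c when m = lead_of e else 0)"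
  using total_degree_lead_of[of e] by (auto simp: lookup_single when_def)

text \<open>Each underlined monomial occurs in its own generator and in no other: the reason for both the
  irredundancy of the generators and their distinctness.  Only the quadratic terms of the generators matter.\<close>
lemma lookup_generator_lead_of:
  fixes e e' :: "'n::{finite,linorder} coord \<times> 'n coord"
  assumes "e \<in> lead_pairs" "e' \<in> lead_pairs"
  shows "Poly_Mapping.lookup (generator e :: ('n coord, 'k::field_char_0) mpoly) (lead_of e') \<noteq> 0
    \<longleftrightarrow> e = e'"
proof -
  let ?c = "Poly_Mapping.lookup (generator e :: ('n coord, 'k) mpoly) (lead_of e')"
  show ?thesis
    using assms(1)
  proof (cases rule: lead_pairs_cases)
    case (1 i j)
    have "?c = (1 when mvar (V i) + mvar (U j) = lead_of e') - (1 when mvar (V j) + mvar (U i) = lead_of e')"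
      by (simp add: 1(2) cubic_expand lookup_add lookup_minus lookup_single_lead_of
          total_degree_add total_degree_mvar)
    with 1 assms(2) show ?thesis
      by (auto simp: lead_of_def mvar_add_eq_iff when_def elim!: lead_pairs_cases split: if_splits)
  next
    case (2 i j)
    have "?c = (4 when mvar (W j) + mvar (U i) = lead_of e') - (3 when mvar (V i) + mvar (V j) = lead_of e')"
      by (simp add: 2 quartic_expand lookup_add lookup_minus lookup_single_lead_of
          total_degree_add total_degree_mvar)
    with 2 assms(2) show ?thesis
      by (auto simp: lead_of_def mvar_add_eq_iff when_def elim!: lead_pairs_cases split: if_splits)
  next
    case (3 i j)
    have "?c = (4 when mvar (W i) + mvar (V j) = lead_of e') - (4 when mvar (W j) + mvar (V i) = lead_of e')"
      by (simp add: 3(2) quintic_expand lookup_add lookup_minus lookup_single_lead_of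
          total_degree_add total_degree_mvar)
    with 3 assms(2) show ?thesis
      by (auto simp: lead_of_def mvar_add_eq_iff when_def elim!: lead_pairs_cases split: if_splits)
  qed
qed

lemma keys_add_subset:
  "Poly_Mapping.keys p \<subseteq> M \<Longrightarrow> Poly_Mapping.keys q \<subseteq> M \<Longrightarrow>
    Poly_Mapping.keys (p + q) \<subseteq> M"
  by (rule subset_trans[OF keys_add Un_least])

lemma keys_diff_subset:
  "Poly_Mapping.keys p \<subseteq> M \<Longrightarrow> Poly_Mapping.keys q \<subseteq> M \<Longrightarrow>
    Poly_Mapping.keys (p - q) \<subseteq> M"
  for p q :: "'a \<Rightarrow>\<^sub>0 'b::ab_group_add"
  by (rule subset_trans[OF keys_diff_subset_Un Un_least])

lemma keys_single_subset: "m \<in> M \<Longrightarrow> Poly_Mapping.keys (Poly_Mapping.single m c) \<subseteq> M"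
  by simp

lemma keys_cubic: "Poly_Mapping.keys (cubic i j) \<subseteq>
    {mvar (V i) + mvar (U j), mvar (V j) + mvar (U i), mvar (U i) + mvar (U i) + mvar (U j),
     mvar (U i) + mvar (U j) + mvar (U j)}"
  unfolding cubic_expand by (intro keys_add_subset keys_diff_subset keys_single_subset;
      simp only: insert_iff simp_thms)

lemma keys_quartic: "Poly_Mapping.keys (quartic i j) \<subseteq>
    {mvar (W j) + mvar (U i), mvar (V i) + mvar (V j), mvar (U i) + mvar (U i) + mvar (V j),
     mvar (U i) + mvar (U j) + mvar (V j), mvar (U i) + mvar (U j) + mvar (U j) + mvar (U j)}"
  unfolding quartic_expand by (intro keys_add_subset keys_diff_subset keys_single_subset;
      simp only: insert_iff simp_thms)

lemma keys_quintic: "Poly_Mapping.keys (quintic i j) \<subseteq>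
    {mvar (W i) + mvar (V j), mvar (W j) + mvar (V i), mvar (U i) + mvar (V j) + mvar (V j),
     mvar (U i) + mvar (V i) + mvar (V j), mvar (U i) + mvar (U i) + mvar (U j) + mvar (V j),
     mvar (U i) + mvar (U j) + mvar (U j) + mvar (V j),
     mvar (U i) + mvar (U i) + mvar (U i) + mvar (V j),
     mvar (U i) + mvar (U i) + mvar (U j) + mvar (U j) + mvar (U j),
     mvar (U i) + mvar (U j) + mvar (U j) + mvar (U j) + mvar (U j)}"
  unfolding quintic_expand by (intro keys_add_subset keys_diff_subset keys_single_subset;
      simp only: insert_iff simp_thms)

lemma weighted_degree_eq: "weighted_degree m = (\<Sum>x\<in>UNIV. weight x * Poly_Mapping.lookup m x)"
  for m :: "'n::finite coord monom"
  unfolding weighted_degree_def by (intro sum.mono_neutral_left) (auto simp: in_keys_iff)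

lemma weighted_degree_add: "weighted_degree (m + n) = weighted_degree m + weighted_degree n"
  for m :: "'n::finite coord monom"
  by (simp add: weighted_degree_eq lookup_add sum.distrib distrib_left)

lemma weighted_degree_mvar: "weighted_degree (mvar x) = weight x"
  by (simp add: weighted_degree_def mvar_def)

lemma weighted_homogeneous_generators:
  fixes i j :: "'n::finite"
  shows "weighted_homogeneous 3 (cubic i j :: ('n coord, 'k::comm_ring_1) mpoly)"
    and "weighted_homogeneous 4 (quartic i j :: ('n coord, 'k) mpoly)"
    and "weighted_homogeneous 5 (quintic i j :: ('n coord, 'k) mpoly)"
  unfolding weighted_homogeneous_def
  by (auto simp: weighted_degree_add weighted_degree_mvar
      dest!: subsetD[OF keys_cubic] subsetD[OF keys_quartic] subsetD[OF keys_quintic])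

lemma total_degree_generator:
  fixes e :: "'n::{finite,linorder} coord \<times> 'n coord"
  assumes "e \<in> lead_pairs" "n \<in> Poly_Mapping.keys (generator e :: ('n coord, 'k::comm_ring_1) mpoly)"
  shows "2 \<le> total_degree n"
  using assms(1)
proof (cases rule: lead_pairs_cases)
  case (1 i j)
  then have "n \<in> Poly_Mapping.keys (cubic i j :: ('n coord, 'k) mpoly)" using assms(2) by simp
  from subsetD[OF keys_cubic this] show ?thesis
    by (auto simp: total_degree_add total_degree_mvar)
next
  case (2 i j)
  then have "n \<in> Poly_Mapping.keys (quartic i j :: ('n coord, 'k) mpoly)" using assms(2) by simp
  from subsetD[OF keys_quartic this] show ?thesis
    by (auto simp: total_degree_add total_degree_mvar)
next
  case (3 i j)
  then have "n \<in> Poly_Mapping.keys (quintic i j :: ('n coord, 'k) mpoly)" using assms(2) by simp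
  from subsetD[OF keys_quintic this] show ?thesis
    by (auto simp: total_degree_add total_degree_mvar)
qed


section \<open>The lexicographic order\<close>

lemma lex_lessI:
  fixes m n :: "'x::linorder monom"
  assumes "Poly_Mapping.lookup n k < Poly_Mapping.lookup m k"
    and "\<And>l. l < k \<Longrightarrow> Poly_Mapping.lookup n l = Poly_Mapping.lookup m l"
  shows "n < m"
  using assms by (auto simp: less_poly_mapping.rep_eq less_fun_def)

lemma monomial_order_lex: "monomial_order ((\<le>) :: 'x::linorder monom \<Rightarrow> 'x monom \<Rightarrow> bool)"
proof -
  have "0 \<le> m" for m :: "'x monom"
  proof (cases "m = 0")
    case False
    then have ne: "Poly_Mapping.keys m \<noteq> {}" by simp
    have "0 < m"
    proof (rule lex_lessI)
      show "Poly_Mapping.lookup 0 (Min (Poly_Mapping.keys m)) < Poly_Mapping.lookup m (Min (Poly_Mapping.keys m))"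
        using Min_in[OF finite_keys ne] by (simp add: in_keys_iff)
      show "Poly_Mapping.lookup 0 l = Poly_Mapping.lookup m l" if "l < Min (Poly_Mapping.keys m)" for l
      proof -
        have "l \<notin> Poly_Mapping.keys m" using leD[OF Min_le[OF finite_keys]] that by blast
        then show ?thesis by (simp add: in_keys_iff)
      qed
    qed
    then show ?thesis by simp
  qed simp
  then show ?thesis
    unfolding monomial_order_def
    by (auto simp: reflp_def transp_def antisymp_def totalp_on_def add_left_mono)
qed

text \<open>In each generator all terms but the underlined one involve only variables less
  significant than the first variable of the underlined term, so this criterion covers every comparison.\<close>
lemma lex_less_mvar:
  fixes x y :: "'x::linorder"
  assumes "x < y" "\<And>k. k \<le> x \<Longrightarrow> Poly_Mapping.lookup n k = 0"
  shows "n < mvar x + mvar y"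
  using assms by (intro lex_lessI[of _ x]) (auto simp: lookup_add mvar_def lookup_single when_def)

lemma lead_monom_lex_generator:
  fixes e :: "'n::{finite,linorder} coord \<times> 'n coord"
  assumes "e \<in> lead_pairs"
  shows "lead_monom (\<le>) (generator e :: ('n coord, 'k::field_char_0) mpoly) = lead_of e"
proof (rule monomial_ordering.lead_monom_eqI[OF monomial_ordering.intro[OF monomial_order_lex]])
  show "lead_of e \<in> Poly_Mapping.keys (generator e :: ('n coord, 'k) mpoly)"
    using lookup_generator_lead_of[OF assms assms] by (simp add: in_keys_iff)
  have less: "n < lead_of (x, y)" if "x < y" "\<And>k. k \<le> x \<Longrightarrow> Poly_Mapping.lookup n k = 0"
    for n and x y :: "'n coord"
    using lex_less_mvar[OF that] by (simp add: lead_of_def)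
  fix n assume n: "n \<in> Poly_Mapping.keys (generator e :: ('n coord, 'k) mpoly)"
  have "n = lead_of e \<or> n < lead_of e"
    using assms
  proof (cases rule: lead_pairs_cases)
    case (1 i j)
    with n have "n \<in> Poly_Mapping.keys (cubic i j :: ('n coord, 'k) mpoly)" by simp
    from subsetD[OF keys_cubic this] have "n = lead_of e \<or> (\<forall>k\<le>V i. Poly_Mapping.lookup n k = 0)"
      using 1 by (auto simp: lead_of_def lookup_add mvar_def lookup_single when_def less_eq_coord_def)
    then show ?thesis using less[of "V i" "U j" n] 1 by auto
  next
    case (2 i j)
    with n have "n \<in> Poly_Mapping.keys (quartic i j :: ('n coord, 'k) mpoly)" by simp
    from subsetD[OF keys_quartic this] have "n = lead_of e \<or> (\<forall>k\<le>W j. Poly_Mapping.lookup n k = 0)"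
      using 2 by (auto simp: lead_of_def lookup_add mvar_def lookup_single when_def less_eq_coord_def)
    then show ?thesis using less[of "W j" "U i" n] 2 by auto
  next
    case (3 i j)
    with n have "n \<in> Poly_Mapping.keys (quintic i j :: ('n coord, 'k) mpoly)" by simp
    from subsetD[OF keys_quintic this] have "n = lead_of e \<or> (\<forall>k\<le>W i. Poly_Mapping.lookup n k = 0)"
      using 3 by (auto simp: lead_of_def lookup_add mvar_def lookup_single when_def less_eq_coord_def)
    then show ?thesis using less[of "W i" "V j" n] 3 by auto
  qed
  then show "n \<le> lead_of e" by auto
qed

lemma selects_underlined_iff:
  "selects_underlined lm \<longleftrightarrow> (\<forall>e\<in>lead_pairs. lm (generator e) = lead_of e)"
proof
  assume *: "selects_underlined lm"
  show "\<forall>e\<in>lead_pairs. lm (generator e) = lead_of e"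
  proof
    fix e assume "e \<in> (lead_pairs :: ('a coord \<times> 'a coord) set)"
    then show "lm (generator e) = lead_of e"
    proof (cases rule: lead_pairs_cases)
      case (2 i j)
      with * show ?thesis
        by (cases "i = j") (simp_all add: selects_underlined_def lead_of_def quartic_diag)
    qed (use * in \<open>auto simp: selects_underlined_def lead_of_def\<close>)
  qed
next
  assume *: "\<forall>e\<in>lead_pairs. lm (generator e) = lead_of e"
  have "lm (cubic i j) = mvar (V i) + mvar (U j)" if "i < j" for i j
    using bspec[OF *, of "(V i, U j)"] that by (simp add: lead_pairs_def lead_of_def)
  moreover have "lm (quartic i j) = mvar (W j) + mvar (U i)" for i j
    using bspec[OF *, of "(W j, U i)"] by (simp add: lead_pairs_def lead_of_def)
  moreover have "lm (quintic i j) = mvar (W i) + mvar (V j)" if "i < j" for i j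
    using bspec[OF *, of "(W i, V j)"] that by (simp add: lead_pairs_def lead_of_def)
  ultimately show "selects_underlined lm"
    by (simp add: selects_underlined_def flip: quartic_diag)
qed


section \<open>Independence of the standard monomials modulo the simplex ideal\<close>

lemma poly_subst_diff: "poly_subst f (p - q) = poly_subst f p - poly_subst f q"
  for p q :: "('x, 'k::comm_ring_1) mpoly"
  using poly_subst_add[of f "p - q" q] by simp

lemma poly_subst_power: "poly_subst f (p ^ n) = poly_subst f p ^ n"
  by (induction n) (simp_all add: poly_subst_mult)

lemma poly_subst_numeral: "poly_subst f (numeral k) = numeral k"
  using poly_subst_Const[of f "numeral k"] by (simp add: Const_def)

lemma poly_subst_prod: "poly_subst f (prod h A) = (\<Prod>a\<in>A. poly_subst f (h a))"
  by (induction A rule: infinite_finite_induct) (simp_all add: poly_subst_mult)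

lemma poly_subst_poly_subst: "poly_subst f (poly_subst h p) = poly_subst (\<lambda>x. poly_subst f (h x)) p"
proof -
  have "poly_subst f (poly_subst h p) = (\<Sum>m\<in>Poly_Mapping.keys p.
      Const (Poly_Mapping.lookup p m) *
      (\<Prod>x\<in>Poly_Mapping.keys m. poly_subst f (h x) ^ Poly_Mapping.lookup m x))"
    by (subst (2) poly_subst_def)
      (simp add: poly_subst_sum poly_subst_mult poly_subst_prod poly_subst_power)
  then show ?thesis by (simp add: poly_subst_def)
qed

text \<open>The substitution \<open>\<kappa>\<^sub>j \<mapsto> x\<^sub>j + z\<close>, \<open>\<kappa>\<^sub>0 \<mapsto> z\<close>, with \<open>kappa j\<close> in the role of \<open>x\<^sub>j\<close> and \<open>kappa0\<close> in the
  role of \<open>z\<close>.  Without it the highest term of \<open>u\<^sub>j\<close> in \<open>\<kappa>\<^sub>0\<close> would be \<open>-\<kappa>\<^sub>0\<close>, independent of \<open>j\<close>.\<close>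
fun shift :: "'n option \<Rightarrow> ('n option, 'k::comm_ring_1) mpoly" where
  "shift None = kappa0"
| "shift (Some j) = kappa j + kappa0"

fun top_monom :: "'n coord \<Rightarrow> 'n option monom" where
  "top_monom (U j) = mvar (Some j)"
| "top_monom (V j) = mvar (Some j) + mvar None"
| "top_monom (W j) = mvar (Some j) + mvar None + mvar None"

fun top_coeff :: "'n coord \<Rightarrow> 'k::comm_ring_1" where
  "top_coeff (U j) = 1"
| "top_coeff (V j) = 2"
| "top_coeff (W j) = 3"

lemma has_top_term_single: "has_top_term z t c (Poly_Mapping.single t c)"
  by (simp add: has_top_term_def)

lemma has_top_term_add_single:
  assumes "has_top_term z t c q" "Poly_Mapping.lookup s z < Poly_Mapping.lookup t z"
  shows "has_top_term z t c (q + Poly_Mapping.single s b)"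
  unfolding has_top_term_def
proof
  fix n assume "n \<in> Poly_Mapping.keys (q + Poly_Mapping.single s b - Poly_Mapping.single t c)"
  moreover have "q + Poly_Mapping.single s b - Poly_Mapping.single t c
      = (q - Poly_Mapping.single t c) + Poly_Mapping.single s b" by simp
  ultimately have "n \<in> Poly_Mapping.keys (q - Poly_Mapping.single t c) \<union> {s}"
    using keys_add[of "q - Poly_Mapping.single t c" "Poly_Mapping.single s b"]
    by (auto split: if_splits)
  then show "Poly_Mapping.lookup n z < Poly_Mapping.lookup t z"
    using assms by (auto simp: has_top_term_def)
qed

lemma has_top_term_parametrization:
  fixes x :: "'n coord"
  shows "has_top_term None (top_monom x) (top_coeff x :: 'k::comm_ring_1) (poly_subst shift (parametrization x))"
    (is "has_top_term _ _ _ ?p")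
proof (cases x)
  case (U j)
  have "?p = cmonom 1 (mvar (Some j))"
    unfolding cmonom_mvar by (simp add: U poly_subst_diff)
  moreover have "has_top_term None (top_monom x) (top_coeff x) \<dots>"
    by (simp add: U has_top_term_single)
  ultimately show ?thesis by simp
next
  case (V j)
  have "?p
      = cmonom 2 (mvar (Some j) + mvar None) + cmonom 1 (mvar (Some j) + mvar (Some j))"
    unfolding cmonom_mvar
    by (simp add: V poly_subst_diff poly_subst_power poly_subst_mult algebra_simps power2_eq_square)
  moreover have "has_top_term None (top_monom x) (top_coeff x) \<dots>"
    by (simp add: V lookup_add mvar_def lookup_single has_top_term_add_single has_top_term_single)
  ultimately show ?thesis by simp
next
  case (W j)
  have "?p = cmonom 3 (mvar (Some j) + mvar None + mvar None)
      + cmonom 3 (mvar (Some j) + mvar (Some j) + mvar None)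
      + cmonom 1 (mvar (Some j) + mvar (Some j) + mvar (Some j))"
    unfolding cmonom_mvar
    by (simp add: W poly_subst_diff poly_subst_power poly_subst_mult algebra_simps power3_eq_cube)
  moreover have "has_top_term None (top_monom x) (top_coeff x) \<dots>"
    by (simp add: W lookup_add mvar_def lookup_single has_top_term_add_single has_top_term_single)
  ultimately show ?thesis by simp
qed

text \<open>The monomials divisible by no underlined monomial; for every order that selects these, they
  contain the standard monomials.\<close>
definition staircase :: "'n::linorder coord monom set" where
  "staircase = {m. \<forall>(x, y)\<in>lead_pairs. Poly_Mapping.lookup m x = 0 \<or> Poly_Mapping.lookup m y = 0}"

lemma staircaseD:
  assumes "m \<in> staircase"
  shows "i < j \<Longrightarrow> Poly_Mapping.lookup m (V i) = 0 \<or> Poly_Mapping.lookup m (U j) = 0"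
    and "Poly_Mapping.lookup m (W j) = 0 \<or> Poly_Mapping.lookup m (U i) = 0"
    and "i < j \<Longrightarrow> Poly_Mapping.lookup m (W i) = 0 \<or> Poly_Mapping.lookup m (V j) = 0"
proof -
  have pair: "Poly_Mapping.lookup m x = 0 \<or> Poly_Mapping.lookup m y = 0" if "(x, y) \<in> lead_pairs" for x y
    using assms that by (auto simp: staircase_def)
  show "i < j \<Longrightarrow> Poly_Mapping.lookup m (V i) = 0 \<or> Poly_Mapping.lookup m (U j) = 0"
    "Poly_Mapping.lookup m (W j) = 0 \<or> Poly_Mapping.lookup m (U i) = 0"
    "i < j \<Longrightarrow> Poly_Mapping.lookup m (W i) = 0 \<or> Poly_Mapping.lookup m (V j) = 0"
    by (rule pair, simp add: lead_pairs_def)+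
qed

text \<open>The exponent of \<open>x\<^sub>j\<close> in the highest term, and the contribution of the variables of index \<open>j\<close> to the
  exponent of \<open>z\<close>.\<close>
definition kappa_degree :: "'n coord monom \<Rightarrow> 'n \<Rightarrow> nat" where
  "kappa_degree m j = Poly_Mapping.lookup m (U j) + Poly_Mapping.lookup m (V j) + Poly_Mapping.lookup m (W j)"

definition kappa0_degree :: "'n coord monom \<Rightarrow> 'n \<Rightarrow> nat" where
  "kappa0_degree m j = Poly_Mapping.lookup m (V j) + 2 * Poly_Mapping.lookup m (W j)"

lemma lookup_monom_map_top_monom:
  "Poly_Mapping.lookup (monom_map top_monom m) (Some j) = kappa_degree m j"
  "Poly_Mapping.lookup (monom_map top_monom m) None = (\<Sum>j\<in>UNIV. kappa0_degree m j)"
  for m :: "'n::finite coord monom"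
proof -
  have "Poly_Mapping.lookup m x * Poly_Mapping.lookup (top_monom x) (Some j)
      = (if x \<in> {U j, V j, W j} then Poly_Mapping.lookup m x else 0)" for x
    by (cases x) (auto simp: lookup_add mvar_def lookup_single when_def)
  then show "Poly_Mapping.lookup (monom_map top_monom m) (Some j) = kappa_degree m j"
    using sum.inter_restrict[of UNIV "Poly_Mapping.lookup m" "{U j, V j, W j}"]
    by (simp only: lookup_monom_map kappa_degree_def) simp
  show "Poly_Mapping.lookup (monom_map top_monom m) None = (\<Sum>j\<in>UNIV. kappa0_degree m j)"
    by (simp add: lookup_monom_map sum_coord lookup_add mvar_def lookup_single
        kappa0_degree_def sum.distrib mult_2)
qed

text \<open>Let \<open>i < j\<close>.  If \<open>m'\<close> has more \<open>z\<close> than \<open>m\<close> at \<open>i\<close>, then \<open>v\<^sub>i\<close> or \<open>w\<^sub>i\<close> divides \<open>m'\<close>.  If \<open>w\<^sub>i\<close> does, only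
  \<open>w\<^sub>j\<close> is possible at \<open>j\<close>, which is the maximum.  Otherwise \<open>m'\<close> has no \<open>u\<^sub>j\<close>, so at least one \<open>z\<close> for each
  occurrence of \<open>j\<close>, whereas \<open>m\<close> contains \<open>u\<^sub>i\<close>, thus no \<open>w\<^sub>j\<close>, so at most one.  Hence \<open>m\<close> cannot have more \<open>z\<close> than \<open>m'\<close>
  at \<open>j\<close>.\<close>
lemma staircase_no_exchange:
  assumes m: "m \<in> staircase" "m' \<in> staircase"
    and deg: "kappa_degree m = kappa_degree m'"
    and ij: "kappa0_degree m i < kappa0_degree m' i" "kappa0_degree m' j < kappa0_degree m j"
  shows False
proof -
  have ordered: False
    if "m \<in> staircase" "m' \<in> staircase" "kappa_degree m = kappa_degree m'" "i < j"
      "kappa0_degree m i < kappa0_degree m' i" "kappa0_degree m' j < kappa0_degree m j"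
    for m m' :: "'a coord monom" and i j
    using staircaseD(1)[OF that(2,4)] staircaseD(2)[OF that(2), of i j] staircaseD(3)[OF that(2,4)]
      staircaseD(2)[OF that(2), of i i] staircaseD(2)[OF that(2), of j i]
      staircaseD(2)[OF that(1), of j i] staircaseD(2)[OF that(1), of i i]
      fun_cong[OF that(3), of i] fun_cong[OF that(3), of j] that(5,6)
    unfolding kappa_degree_def kappa0_degree_def
    by linarith
  from ij(1,2) have "i < j \<or> j < i" by (cases "i = j") auto
  then show False
    using ordered[of m m' i j] ordered[of m' m j i] assms by auto
qed

text \<open>As there is no exchange, the distributions of \<open>z\<close> over the indices of two standard monomials with the
  same image are comparable; having equal sums, they agree.  At a single index the exponents of \<open>x\<^sub>j\<close> and \<open>z\<close>
  determine the monomial because \<open>u\<^sub>j\<close> and \<open>w\<^sub>j\<close> do not both occur.\<close>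
lemma inj_on_staircase:
  "inj_on (monom_map top_monom) (staircase :: 'n::{finite,linorder} coord monom set)"
proof (rule inj_onI)
  fix m m' :: "'n coord monom"
  assume m: "m \<in> staircase" "m' \<in> staircase"
    and eq: "monom_map top_monom m = monom_map top_monom m'"
  have deg: "kappa_degree m = kappa_degree m'"
    using arg_cong[OF eq, of Poly_Mapping.lookup]
    by (auto simp: fun_eq_iff simp flip: lookup_monom_map_top_monom)
  have sum: "(\<Sum>j\<in>UNIV. kappa0_degree m j) = (\<Sum>j\<in>UNIV. kappa0_degree m' j)"
    using eq by (simp flip: lookup_monom_map_top_monom)
  have "(\<forall>j. kappa0_degree m j \<le> kappa0_degree m' j) \<or> (\<forall>j. kappa0_degree m' j \<le> kappa0_degree m j)"
    using staircase_no_exchange[OF m deg] by (meson not_le)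
  then have eq0: "kappa0_degree m j = kappa0_degree m' j" for j
    using sum_mono_inv[of "kappa0_degree m" UNIV "kappa0_degree m'" j]
      sum_mono_inv[of "kappa0_degree m'" UNIV "kappa0_degree m" j] sum by auto
  have coords: "Poly_Mapping.lookup m (U j) = Poly_Mapping.lookup m' (U j) \<and>
      Poly_Mapping.lookup m (V j) = Poly_Mapping.lookup m' (V j) \<and>
      Poly_Mapping.lookup m (W j) = Poly_Mapping.lookup m' (W j)" for j
    using staircaseD(2)[OF m(1), of j j] staircaseD(2)[OF m(2), of j j]
      fun_cong[OF deg, of j] eq0[of j]
    unfolding kappa_degree_def kappa0_degree_def by linarith
  show "m = m'"
  proof (rule poly_mapping_eqI)
    show "Poly_Mapping.lookup m x = Poly_Mapping.lookup m' x" for x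
      using coords by (cases x) auto
  qed
qed

lemma simplex_ideal_staircase:
  fixes p :: "('n::{finite,linorder} coord, 'k::field_char_0) mpoly"
  assumes "p \<in> simplex_ideal" "Poly_Mapping.keys p \<subseteq> staircase"
  shows "p = 0"
proof (rule poly_subst_eq_0_imp[OF has_top_term_parametrization _ inj_on_staircase assms(2)])
  show "top_coeff x \<noteq> (0 :: 'k)" for x :: "'n coord" by (cases x) auto
  show "poly_subst (\<lambda>x. poly_subst shift (parametrization x)) p = 0"
    using assms(1) by (simp add: simplex_ideal_def flip: poly_subst_poly_subst)
qed


section \<open>The Groebner basis\<close>

lemma subspace_simplex_ideal:
  "module.subspace (*) (simplex_ideal :: ('n coord, 'k::comm_ring_1) mpoly set)"
proof -
  interpret ideal: module "(*) :: ('n coord, 'k) mpoly \<Rightarrow> ('n coord, 'k) mpoly \<Rightarrow> ('n coord, 'k) mpoly"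
    by (rule module_times)
  show ?thesis
    by (rule ideal.subspaceI) (simp_all add: simplex_ideal_def poly_subst_add poly_subst_mult)
qed

lemma generator_in_simplex_ideal: "generator e \<in> simplex_ideal"
proof -
  note hom = poly_subst_diff poly_subst_add poly_subst_mult poly_subst_power poly_subst_numeral
  have "poly_subst parametrization (cubic i j) = 0" for i j :: 'a
    by (simp add: cubic_def hom algebra_simps eval_nat_numeral)
  moreover have "poly_subst parametrization (quartic i j) = 0" for i j :: 'a
    by (simp add: quartic_def hom algebra_simps eval_nat_numeral)
  moreover have "poly_subst parametrization (quintic i j) = 0" for i j :: 'a
    by (simp add: quintic_def hom algebra_simps eval_nat_numeral)
  ultimately show ?thesis
    by (cases e rule: generator.cases) (simp_all add: simplex_ideal_def)
qed

lemma inj_on_generator: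
  "inj_on (generator :: _ \<Rightarrow> ('n::{finite,linorder} coord, 'k::field_char_0) mpoly) lead_pairs"
proof (rule inj_onI)
  fix e e' :: "'n coord \<times> 'n coord"
  assume "e \<in> lead_pairs" "e' \<in> lead_pairs"
    and "(generator e :: ('n coord, 'k) mpoly) = generator e'"
  then show "e = e'"
    using lookup_generator_lead_of[of e e', where 'k = 'k] lookup_generator_lead_of[of e' e', where 'k = 'k]
    by simp
qed

lemma card_off_diagonal: "card {(i, j). i \<noteq> (j :: 'n::finite)} = CARD('n) * (CARD('n) - 1)"
proof -
  have "{(i, j). i \<noteq> (j :: 'n)} = UNIV \<times> UNIV - range (\<lambda>i. (i, i))" by auto
  then have "card {(i, j). i \<noteq> (j :: 'n)} = CARD('n) * CARD('n) - card (range (\<lambda>i::'n. (i, i)))"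
    by (simp add: card_Diff_subset)
  also have "card (range (\<lambda>i::'n. (i, i))) = CARD('n)"
    by (intro card_image) (simp add: inj_def)
  finally show ?thesis by (simp add: diff_mult_distrib2)
qed

lemma card_less_pairs: "card {(i, j). i < (j :: 'n::{finite,linorder})} = CARD('n) choose 2"
proof -
  let ?L = "{(i, j). i < (j :: 'n)}"
  have "{(i, j). i \<noteq> (j :: 'n)} = ?L \<union> prod.swap ` ?L"
    by (force simp: image_iff)
  moreover have "card (?L \<union> prod.swap ` ?L) = card ?L + card (prod.swap ` ?L)"
    by (intro card_Un_disjoint) auto
  moreover have "card (prod.swap ` ?L) = card ?L"
    by (intro card_image) (simp add: inj_on_def)
  ultimately have "2 * card ?L = CARD('n) * (CARD('n) - 1)"
    using card_off_diagonal[where 'n = 'n] by simp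
  then show ?thesis by (simp add: choose_two)
qed

lemma card_generator_image:
  assumes "inj_on h P" "h ` P \<subseteq> lead_pairs"
  shows "card ((\<lambda>p. generator (h p) :: ('n::{finite,linorder} coord, 'k::field_char_0) mpoly) ` P) = card P"
  using card_image[OF comp_inj_on[OF assms(1) inj_on_subset[OF inj_on_generator assms(2)]]]
  by (simp add: o_def)

lemma card_families:
  shows "card (cubics :: ('n::{finite,linorder} coord, 'k::field_char_0) mpoly set) = CARD('n) choose 2"
    and "card (diag_quartics :: ('n coord, 'k) mpoly set) = CARD('n)"
    and "card (quartics :: ('n coord, 'k) mpoly set) = CARD('n) * (CARD('n) - 1)"
    and "card (quintics :: ('n coord, 'k) mpoly set) = CARD('n) choose 2"
proof -
  let ?gen = "generator :: _ \<Rightarrow> ('n coord, 'k) mpoly"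
  have "cubics = (\<lambda>p. ?gen (V (fst p), U (snd p))) ` {(i, j). i < j}"
    by (force simp: cubics_def)
  also have "card \<dots> = card {(i, j). i < (j :: 'n)}"
    by (intro card_generator_image) (auto simp: inj_on_def lead_pairs_def)
  finally show "card (cubics :: ('n coord, 'k) mpoly set) = CARD('n) choose 2"
    by (simp add: card_less_pairs)
  have "diag_quartics = (\<lambda>i. ?gen (W i, U i)) ` UNIV"
    by (force simp: diag_quartics_def quartic_diag)
  also have "card \<dots> = CARD('n)"
    by (intro card_generator_image) (auto simp: inj_on_def lead_pairs_def)
  finally show "card (diag_quartics :: ('n coord, 'k) mpoly set) = CARD('n)" .
  have "quartics = (\<lambda>p. ?gen (W (snd p), U (fst p))) ` {(i, j). i \<noteq> j}"
    by (force simp: quartics_def)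
  also have "card \<dots> = card {(i, j). i \<noteq> (j :: 'n)}"
    by (intro card_generator_image) (auto simp: inj_on_def lead_pairs_def)
  finally show "card (quartics :: ('n coord, 'k) mpoly set) = CARD('n) * (CARD('n) - 1)"
    by (simp add: card_off_diagonal)
  have "quintics = (\<lambda>p. ?gen (W (fst p), V (snd p))) ` {(i, j). i < j}"
    by (force simp: quintics_def)
  also have "card \<dots> = card {(i, j). i < (j :: 'n)}"
    by (intro card_generator_image) (auto simp: inj_on_def lead_pairs_def)
  finally show "card (quintics :: ('n coord, 'k) mpoly set) = CARD('n) choose 2"
    by (simp add: card_less_pairs)
qed

lemma card_lead_pairs:
  "card (lead_pairs :: ('n::{finite,linorder} coord \<times> 'n coord) set) = 2 * CARD('n)^2 - CARD('n)"
proof -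
  let ?L = "{(i, j). i < (j :: 'n)}"
  let ?VU = "(\<lambda>(i, j). (V i, U j)) ` ?L" and ?WU = "(\<lambda>(i :: 'n, j :: 'n). (W i, U j)) ` UNIV"
    and ?WV = "(\<lambda>(i, j). (W i, V j)) ` ?L"
  have "lead_pairs = ?VU \<union> ?WU \<union> ?WV"
    by (auto simp: lead_pairs_def image_iff)
  moreover have "card (?VU \<union> ?WU \<union> ?WV) = card ?VU + card ?WU + card ?WV"
    by (subst card_Un_disjoint; auto)+
  moreover have "card ?VU = CARD('n) choose 2" "card ?WV = CARD('n) choose 2"
    by (subst card_image; auto simp: inj_on_def card_less_pairs)+
  moreover have "card ?WU = CARD('n) * CARD('n)"
    by (subst card_image) (auto simp: inj_on_def)
  ultimately have "card (lead_pairs :: ('n coord \<times> 'n coord) set)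
      = 2 * (CARD('n) choose 2) + CARD('n) * CARD('n)" by simp
  also have "2 * (CARD('n) choose 2) = CARD('n) * (CARD('n) - 1)"
    by (simp add: choose_two)
  finally show ?thesis by (simp add: power2_eq_square diff_mult_distrib2)
qed

lemma families_eq:
  "(cubics \<union> diag_quartics \<union> quartics \<union> quintics :: ('n::linorder coord, 'k::comm_ring_1) mpoly set)
    = generator ` lead_pairs"
proof
  have "(generator e :: ('n coord, 'k) mpoly) \<in> cubics \<union> diag_quartics \<union> quartics \<union> quintics"
    if "e \<in> lead_pairs" for e :: "'n coord \<times> 'n coord"
    using that
  proof (cases rule: lead_pairs_cases)
    case (2 i j)
    then show ?thesis
      by (cases "i = j") (auto simp: quartics_def diag_quartics_def quartic_diag)
  qed (auto simp: cubics_def quintics_def)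
  then show "(generator :: _ \<Rightarrow> ('n coord, 'k) mpoly) ` lead_pairs
      \<subseteq> cubics \<union> diag_quartics \<union> quartics \<union> quintics" by blast
next
  have mem: "p \<in> generator ` lead_pairs" if "(x, y) \<in> lead_pairs" "p = generator (x, y)"
    for p :: "('n coord, 'k) mpoly" and x y
    using that by blast
  show "cubics \<union> diag_quartics \<union> quartics \<union> quintics
      \<subseteq> (generator :: _ \<Rightarrow> ('n coord, 'k) mpoly) ` lead_pairs"
    unfolding cubics_def diag_quartics_def quartics_def quintics_def
  proof safe
    fix i j :: 'n
    show "(cubic i j :: ('n coord, 'k) mpoly) \<in> generator ` lead_pairs" if "i < j"
      by (rule mem[of "V i" "U j"]) (simp_all add: lead_pairs_def that)
    show "(diag_quartic i :: ('n coord, 'k) mpoly) \<in> generator ` lead_pairs"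
      by (rule mem[of "W i" "U i"]) (simp_all add: lead_pairs_def quartic_diag)
    show "(quartic i j :: ('n coord, 'k) mpoly) \<in> generator ` lead_pairs"
      by (rule mem[of "W j" "U i"]) (simp_all add: lead_pairs_def)
    show "(quintic i j :: ('n coord, 'k) mpoly) \<in> generator ` lead_pairs" if "i < j"
      by (rule mem[of "W i" "V j"]) (simp_all add: lead_pairs_def that)
  qed
qed

text \<open>Independence of the standard monomials does not involve the order, so one argument serves all
  orders that select the underlined monomials.\<close>
context
  fixes le :: "'n::{finite,linorder} coord monom \<Rightarrow> 'n coord monom \<Rightarrow> bool"
    and G :: "('n coord, 'k::field_char_0) mpoly set"
  assumes le: "monomial_order le"
    and lead: "\<And>e. e \<in> lead_pairs \<Longrightarrow> lead_monom le (generator e :: ('n coord, 'k) mpoly) = lead_of e"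
    and G: "G = generator ` lead_pairs"
begin

interpretation monomial_ordering le
  by unfold_locales (rule le)

lemma standard_monomials_staircase: "standard_monomials G \<subseteq> staircase"
proof
  fix m assume m: "m \<in> standard_monomials G"
  have "Poly_Mapping.lookup m x = 0 \<or> Poly_Mapping.lookup m y = 0"
    if xy: "(x, y) \<in> lead_pairs" for x y
  proof (rule ccontr)
    assume "\<not> (Poly_Mapping.lookup m x = 0 \<or> Poly_Mapping.lookup m y = 0)"
    moreover have "x \<noteq> y" using xy by (auto simp: lead_pairs_def)
    ultimately have "divides_monom (lead_of (x, y)) m"
      by (auto simp: lead_of_def lookup_add mvar_def lookup_single when_def)
    then obtain l where "m = l + lead_of (x, y)" by (rule divides_monom_cofactor)
    then have "m = l + lead_monom le (generator (x, y) :: ('n coord, 'k) mpoly)"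
      using lead[OF xy] by simp
    then show False
      using m xy by (auto simp: standard_monomials_def G)
  qed
  then show "m \<in> staircase"
    unfolding staircase_def mem_Collect_eq case_prod_beta by (metis prod.collapse)
qed

lemma zero_notin_G: "0 \<notin> G"
proof
  assume "0 \<in> G"
  then obtain e where e: "e \<in> lead_pairs" "generator e = (0 :: ('n coord, 'k) mpoly)"
    by (auto simp: G)
  then show False using lookup_generator_lead_of[OF e(1) e(1), where 'k = 'k] by simp
qed

lemma
  shows ideal_of_G: "ideal_of G = simplex_ideal"
    and groebner_basis_G: "groebner_basis le G simplex_ideal"
proof -
  have "finite G" by (simp add: G)
  moreover have "G \<subseteq> simplex_ideal" using generator_in_simplex_ideal by (auto simp: G)
  moreover have "p = 0" if "p \<in> simplex_ideal" "Poly_Mapping.keys p \<subseteq> standard_monomials G"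
    for p :: "('n coord, 'k) mpoly"
    using simplex_ideal_staircase that standard_monomials_staircase by blast
  ultimately show "ideal_of G = simplex_ideal" "groebner_basis le G simplex_ideal"
    using groebner_basisI[OF le _ zero_notin_G _ subspace_simplex_ideal] by blast+
qed

lemma minimal_groebner_basis_G: "minimal_groebner_basis le G simplex_ideal"
  unfolding minimal_groebner_basis_def
proof (intro conjI ballI groebner_basis_G zero_notin_G notI)
  fix p assume "p \<in> G"
  then obtain e where e: "e \<in> lead_pairs" "p = generator e" by (auto simp: G)
  assume "Monom (lead_monom le p) \<in> initial_ideal le (G - {p})"
  then have "(Monom (lead_of e) :: ('n coord, 'k) mpoly)
      \<in> ideal_of ((\<lambda>q. Monom (lead_monom le q)) ` (G - {p} - {0}))"
    using lead e by (simp add: initial_ideal_def)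
  moreover have "\<exists>e'\<in>lead_pairs. e' \<noteq> e \<and> q = Monom (lead_of e')"
    if "q \<in> (\<lambda>q. Monom (lead_monom le q)) ` (G - {p} - {0})" for q :: "('n coord, 'k) mpoly"
    using that lead e by (auto simp: G)
  moreover have "Poly_Mapping.lookup (Monom (lead_of e') :: ('n coord, 'k) mpoly) (lead_of e) = 0"
    if "e' \<in> lead_pairs" "e' \<noteq> e" for e'
    using inj_onD[OF inj_on_lead_of _ that(1) e(1)] that(2) by (auto simp: Monom_def lookup_single when_def)
  ultimately have "Poly_Mapping.lookup (Monom (lead_of e) :: ('n coord, 'k) mpoly) (lead_of e) = 0"
    by (elim ideal_coeff_eq_0[rotated 2]) (fastforce simp: Monom_def total_degree_lead_of)+
  then show False by (simp add: Monom_def)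
qed

lemma minimally_generates_G: "minimally_generates G simplex_ideal"
  unfolding minimally_generates_def
proof (intro conjI allI impI notI ideal_of_G)
  fix H assume H: "H \<subset> G" "ideal_of H = simplex_ideal"
  then obtain e where e: "e \<in> lead_pairs" "generator e \<notin> H" by (auto simp: G)
  have mem: "generator e \<in> ideal_of H"
    using generator_in_simplex_ideal by (simp add: H(2))
  have "Poly_Mapping.lookup (generator e :: ('n coord, 'k) mpoly) (lead_of e) = 0"
  proof (rule ideal_coeff_eq_0[OF _ _ mem])
    fix q assume "q \<in> H"
    with H(1) obtain e' where e': "e' \<in> lead_pairs" "q = generator e'"
      unfolding G by blast
    with e \<open>q \<in> H\<close> have "e' \<noteq> e" by auto
    then show "Poly_Mapping.lookup q (lead_of e) = 0"
      using lookup_generator_lead_of[OF e'(1) e(1), where 'k = 'k] by (simp add: e'(2))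
    fix n assume "n \<in> Poly_Mapping.keys q"
    then show "total_degree (lead_of e) \<le> total_degree n"
      using total_degree_generator[OF e'(1), where 'k = 'k] by (simp add: e'(2) total_degree_lead_of)
  qed
  then show False using lookup_generator_lead_of[OF e(1) e(1), where 'k = 'k] by simp
qed

end

theorem theorem10:
  fixes I A B C D G :: "('n::{finite,linorder} coord, 'k::field_char_0) mpoly set"
  assumes I: "I = simplex_ideal"
    and families: "A = cubics" "B = diag_quartics" "C = quartics" "D = quintics"
    and G: "G = A \<union> B \<union> C \<union> D"
  shows "card A = CARD('n) choose 2 \<and> (\<forall>p\<in>A. weighted_homogeneous 3 p) \<and>
    card B = CARD('n) \<and> (\<forall>p\<in>B. weighted_homogeneous 4 p) \<and>
    card C = CARD('n) * (CARD('n) - 1) \<and> (\<forall>p\<in>C. weighted_homogeneous 4 p) \<and>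
    card D = CARD('n) choose 2 \<and> (\<forall>p\<in>D. weighted_homogeneous 5 p) \<and>
    card G = 2 * CARD('n)^2 - CARD('n) \<and>
    minimally_generates G I \<and>
    (\<exists>le. monomial_order le \<and>
      selects_underlined (lead_monom le :: ('n coord, 'k) mpoly \<Rightarrow> 'n coord monom)) \<and>
    (\<forall>le. monomial_order le \<and>
      selects_underlined (lead_monom le :: ('n coord, 'k) mpoly \<Rightarrow> 'n coord monom) \<longrightarrow>
      minimal_groebner_basis le G I)"
proof -
  have G_eq: "G = generator ` lead_pairs"
    using families_eq by (simp add: G families)
  have card_G: "card G = 2 * CARD('n)^2 - CARD('n)"
  proof -
    have "card G = card (lead_pairs :: ('n coord \<times> 'n coord) set)"
      unfolding G_eq by (rule card_image[OF inj_on_generator])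
    also have "\<dots> = 2 * CARD('n)^2 - CARD('n)"
      by (rule card_lead_pairs)
    finally show ?thesis .
  qed
  have homogeneous: "\<forall>p\<in>A. weighted_homogeneous 3 p" "\<forall>p\<in>B. weighted_homogeneous 4 p"
    "\<forall>p\<in>C. weighted_homogeneous 4 p" "\<forall>p\<in>D. weighted_homogeneous 5 p"
    using weighted_homogeneous_generators
    by (auto simp: families cubics_def diag_quartics_def quartics_def quintics_def simp flip: quartic_diag)
  have lex: "monomial_order ((\<le>) :: 'n coord monom \<Rightarrow> _)"
      "selects_underlined (lead_monom (\<le>) :: ('n coord, 'k) mpoly \<Rightarrow> 'n coord monom)"
    using monomial_order_lex lead_monom_lex_generator by (auto simp: selects_underlined_iff)
  then have "minimally_generates G I"
    using minimally_generates_G[OF monomial_order_lex lead_monom_lex_generator G_eq] by (simp add: I)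
  moreover have "minimal_groebner_basis le G I"
    if "monomial_order le" "selects_underlined (lead_monom le :: ('n coord, 'k) mpoly \<Rightarrow> 'n coord monom)" for le
    using minimal_groebner_basis_G[OF that(1) _ G_eq] that(2) by (simp add: I selects_underlined_iff)
  ultimately show ?thesis
    using card_G homogeneous lex families
      card_families[where 'n = 'n and 'k = 'k] by blast
qed

end
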